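(* Let $n\ge1$, $e\subset\{1,\dots,n\}$, $e\ne\emptyset$, $j\in\mathbb{Z}$, $a\in I_2^n$. Then the function $$\Psi^{(0)}_{e;ja}(x)=2^{-nj/2}\chi_2\big(2^{-1}k_e\cdot(2^jx-a)\big)\,\Omega\big(|2^jx-a|_2\big),\qquad x\in\mathbb{Q}_2^n,$$ is an eigenfunction of the Taibleson fractional operator $D^\alpha$ with eigenvalue $2^{\alpha(1-j)}$, i.e. $$D^\alpha\Psi^{(0)}_{e;ja}=2^{\alpha(1-j)}\Psi^{(0)}_{e;ja},\qquad \alpha\in\mathbb{C}.$$
   Context: $\mathbb{Q}_2$ is the field of $2$-adic numbers; on $\mathbb{Q}_2^n$ use the norm $|x|_2=\max_\nu|x_\nu|_2$ and the product Haar measure $d^nx$ normalized so that $\mathbb{Z}_2^n$ has measure $1$. $\chi_2(t)=e^{2\pi i\{t\}_2}$, $t\in\mathbb{Q}_2$, with $\{t\}_2$ the $2$-adic fractional part; $\xi\cdot x=\sum_\nu\xi_\nu x_\nu$. $\Omega(t)=1$ for $0\le t\le1$, $\Omega(t)=0$ for $t>1$. $I_2=\{2^{-\gamma}(a_0+a_12+\cdots+a_{\gamma-1}2^{\gamma-1}):\gamma\in\mathbb{N},\ a_j\in\{0,1\}\}\subset\mathbb{Q}_2$, $I_2^n=I_2\times\cdots\times I_2$. For $e\subset\{1,\dots,n\}$, $k_e\in\{0,1\}^n$ has $(k_e)_\nu=1$ if $\nu\in e$ and $0$ otherwise. Fourier transform on locally constant compactly supported functions: $F[\varphi](\xi)=\int_{\mathbb{Q}_2^n}\chi_2(\xi\cdot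 x)\varphi(x)\,d^nx$, with inverse $F^{-1}[\varphi](x)=\int_{\mathbb{Q}_2^n}\chi_2(-x\cdot\xi)\varphi(\xi)\,d^n\xi$. The Lizorkin space $\Phi(\mathbb{Q}_2^n)$ consists of the locally constant compactly supported $\phi:\mathbb{Q}_2^n\to\mathbb{C}$ with $\int\phi\,d^nx=0$ (equivalently $F[\phi](0)=0$); each $\Psi^{(0)}_{e;ja}$ belongs to it. For $\alpha\in\mathbb{C}$, the Taibleson fractional operator on $\Phi(\mathbb{Q}_2^n)$ is the pseudo-differential operator with symbol $|\xi|_2^\alpha$: $D^\alpha\phi=F^{-1}\big[|\cdot|_2^\alpha F[\phi]\big]$ (here $F[\phi]$ vanishes near $0$ and the product is taken to be $0$ at $0$); equivalently, it is convolution with the Riesz kernel $\kappa_{-\alpha}$. *)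

theory Defs
  imports "HOL-Analysis.Analysis" "HOL-Computational_Algebra.Primes"
begin

section \<open>The 2-adic absolute value on the rationals\<close>

definition abs2 :: "rat \<Rightarrow> real" where
  "abs2 r = (if r = 0 then 0 else
     2 powi (int (multiplicity 2 (snd (quotient_of r))) - int (multiplicity 2 (fst (quotient_of r)))))"

lemma abs2_Fract:
  assumes "a \<noteq> 0" "b \<noteq> 0"
  shows "abs2 (Fract a b) = 2 powi (int (multiplicity 2 b) - int (multiplicity 2 a))"
proof -
  obtain p q where pq: "quotient_of (Fract a b) = (p, q)" by force
  have q: "q > 0" using quotient_of_denom_pos[OF pq] .
  have e: "Fract p q = Fract a b" using quotient_of_eq[OF pq] .
  then have c: "p * b = a * q" using assms q by (simp add: eq_rat)
  then have p: "p \<noteq> 0" using assms q by auto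
  have "multiplicity 2 p + multiplicity 2 b = multiplicity 2 a + multiplicity 2 q"
    using arg_cong[OF c, of "multiplicity 2"] p q assms
    by (simp add: prime_elem_multiplicity_mult_distrib)
  then have "int (multiplicity 2 q) - int (multiplicity 2 p) =
      int (multiplicity 2 b) - int (multiplicity 2 a)" by linarith
  moreover have "Fract a b \<noteq> 0" using assms by (simp add: Zero_rat_def eq_rat)
  ultimately show ?thesis by (simp add: abs2_def pq)
qed

lemma abs2_0 [simp]: "abs2 0 = 0"
  by (simp add: abs2_def)

lemma abs2_eq_0 [simp]: "abs2 r = 0 \<longleftrightarrow> r = 0"
  by (simp add: abs2_def)

lemma abs2_nonneg [simp]: "0 \<le> abs2 r"
  by (simp add: abs2_def)

lemma abs2_1 [simp]: "abs2 1 = 1"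
  by (simp add: abs2_def)

lemma abs2_mult: "abs2 (r * s) = abs2 r * abs2 s"
proof (cases "r = 0 \<or> s = 0")
  case False
  obtain a b where r: "r = Fract a b" "b > 0" by (cases r) auto
  obtain c d where s: "s = Fract c d" "d > 0" by (cases s) auto
  have "a \<noteq> 0" "c \<noteq> 0" using False r s by (auto simp: rat_number_collapse)
  then have "abs2 (r * s) = 2 powi ((int (multiplicity 2 b) - int (multiplicity 2 a)) +
      (int (multiplicity 2 d) - int (multiplicity 2 c)))"
    using r s by (simp add: abs2_Fract prime_elem_multiplicity_mult_distrib add_diff_add)
  also have "\<dots> = abs2 r * abs2 s"
    using r s \<open>a \<noteq> 0\<close> \<open>c \<noteq> 0\<close> by (subst power_int_add) (simp_all add: abs2_Fract)
  finally show ?thesis .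
qed auto

lemma abs2_inverse: "abs2 (inverse r) = inverse (abs2 r)"
proof (cases "r = 0")
  case False
  then have "abs2 r * abs2 (inverse r) = 1" by (simp add: abs2_mult [symmetric])
  then show ?thesis by (metis inverse_unique)
qed auto

lemma abs2_minus [simp]: "abs2 (- r) = abs2 r"
proof -
  have "multiplicity (2::int) (- 1) = 0" by (rule not_dvd_imp_multiplicity_0) simp
  then have "abs2 (-1) = 1" by (simp add: abs2_def)
  then show ?thesis using abs2_mult[of "-1" r] by simp
qed

lemma abs2_minus_commute: "abs2 (r - s) = abs2 (s - r)"
  using abs2_minus[of "r - s"] by simp

lemma abs2_add_max: "abs2 (r + s) \<le> max (abs2 r) (abs2 s)"
proof (cases "r = 0 \<or> s = 0 \<or> r + s = 0")
  case False
  obtain a b where r: "r = Fract a b" "b > 0" by (cases r) auto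
  obtain c d where s: "s = Fract c d" "d > 0" by (cases s) auto
  have nz: "a \<noteq> 0" "c \<noteq> 0" using False r s by (auto simp: rat_number_collapse)
  have rs: "r + s = Fract (a * d + c * b) (b * d)" using r s by simp
  have nz': "a * d + c * b \<noteq> 0" using False rs by (auto simp: rat_number_collapse)
  let ?k = "min (multiplicity 2 (a * d)) (multiplicity 2 (c * b))"
  have "2 ^ ?k dvd a * d" "2 ^ ?k dvd c * b"
    by (meson min.cobounded1 min.cobounded2 multiplicity_dvd')+
  then have "2 ^ ?k dvd a * d + c * b" by simp
  then have k: "?k \<le> multiplicity 2 (a * d + c * b)"
    using nz' by (intro multiplicity_geI) auto
  have "abs2 (r + s) = 2 powi (int (multiplicity 2 (b * d)) - int (multiplicity 2 (a * d + c * b)))"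
    unfolding rs using nz' r s by (intro abs2_Fract) auto
  moreover have "abs2 r = 2 powi (int (multiplicity 2 (b * d)) - int (multiplicity 2 (a * d)))"
    using nz r s by (simp add: abs2_Fract prime_elem_multiplicity_mult_distrib)
  moreover have "abs2 s = 2 powi (int (multiplicity 2 (b * d)) - int (multiplicity 2 (c * b)))"
    using nz r s by (simp add: abs2_Fract prime_elem_multiplicity_mult_distrib)
  moreover have "(2::real) powi i \<le> 2 powi j" if "i \<le> j" for i j :: int
    using that by (simp add: power_int_increasing)
  ultimately show ?thesis using k by (auto simp: le_max_iff_disj min_le_iff_disj)
qed (auto simp: le_max_iff_disj)

lemma abs2_add_le: "abs2 (r + s) \<le> abs2 r + abs2 s"
  using abs2_add_max[of r s] abs2_nonneg[of r] abs2_nonneg[of s] by linarith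

lemma abs2_diff_le: "abs2 (r - s) \<le> abs2 r + abs2 s"
  using abs2_add_le[of r "- s"] by simp

lemma abs2_abs_diff: "\<bar>abs2 r - abs2 s\<bar> \<le> abs2 (r - s)"
  using abs2_add_le[of "r - s" s] abs2_add_le[of "s - r" r] abs2_minus_commute[of r s] by simp


section \<open>The field of 2-adic numbers as the completion of the rationals\<close>

definition vanishes2 :: "(nat \<Rightarrow> rat) \<Rightarrow> bool" where
  "vanishes2 X \<longleftrightarrow> (\<lambda>n. abs2 (X n)) \<longlonglongrightarrow> 0"

definition cauchy2 :: "(nat \<Rightarrow> rat) \<Rightarrow> bool" where
  "cauchy2 X \<longleftrightarrow> (\<forall>e>0. \<exists>N. \<forall>m\<ge>N. \<forall>n\<ge>N. abs2 (X m - X n) < e)"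

lemma vanishes2_bound:
  assumes "f \<longlonglongrightarrow> 0" "eventually (\<lambda>n. abs2 (X n) \<le> f n) sequentially"
  shows "vanishes2 X"
  unfolding vanishes2_def
  by (rule tendsto_sandwich[OF _ assms(2) tendsto_const assms(1)]) simp

lemma vanishes2_const [simp]: "vanishes2 (\<lambda>n. c) \<longleftrightarrow> c = 0"
  by (simp add: vanishes2_def LIMSEQ_const_iff)

lemma vanishes2_minus: "vanishes2 X \<Longrightarrow> vanishes2 (\<lambda>n. - X n)"
  by (simp add: vanishes2_def)

lemma vanishes2_add:
  assumes "vanishes2 X" "vanishes2 Y"
  shows "vanishes2 (\<lambda>n. X n + Y n)"
proof (rule vanishes2_bound)
  show "(\<lambda>n. abs2 (X n) + abs2 (Y n)) \<longlonglongrightarrow> 0"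
    using tendsto_add[OF assms[unfolded vanishes2_def]] by simp
qed (simp add: abs2_add_le)

lemma vanishes2_diff: "vanishes2 X \<Longrightarrow> vanishes2 Y \<Longrightarrow> vanishes2 (\<lambda>n. X n - Y n)"
  using vanishes2_add[OF _ vanishes2_minus] by simp

lemma cauchy2_const [simp]: "cauchy2 (\<lambda>n. c)"
  by (simp add: cauchy2_def)

lemma cauchy2_minus: "cauchy2 X \<Longrightarrow> cauchy2 (\<lambda>n. - X n)"
  by (simp add: cauchy2_def abs2_minus_commute)

lemma cauchy2_add:
  assumes "cauchy2 X" "cauchy2 Y"
  shows "cauchy2 (\<lambda>n. X n + Y n)"
  unfolding cauchy2_def
proof (intro allI impI)
  fix e :: real assume "e > 0"
  then obtain M N where M: "\<forall>m\<ge>M. \<forall>n\<ge>M. abs2 (X m - X n) < e"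
    and N: "\<forall>m\<ge>N. \<forall>n\<ge>N. abs2 (Y m - Y n) < e"
    using assms unfolding cauchy2_def by metis
  have "abs2 (X m + Y m - (X n + Y n)) < e" if "m \<ge> max M N" "n \<ge> max M N" for m n
  proof -
    have "abs2 (X m - X n) < e" "abs2 (Y m - Y n) < e" using M N that by auto
    then show ?thesis using abs2_add_max[of "X m - X n" "Y m - Y n"]
      by (simp add: add_diff_add)
  qed
  then show "\<exists>N. \<forall>m\<ge>N. \<forall>n\<ge>N. abs2 (X m + Y m - (X n + Y n)) < e" by blast
qed

lemma cauchy2_abs2_convergent:
  assumes "cauchy2 X"
  shows "convergent (\<lambda>n. abs2 (X n))"
proof -
  have "Cauchy (\<lambda>n. abs2 (X n))"
    unfolding Cauchy_def dist_real_def
    using assms unfolding cauchy2_def by (meson abs2_abs_diff le_less_trans)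
  then show ?thesis by (simp add: Cauchy_convergent_iff)
qed

lemma cauchy2_bounded:
  assumes "cauchy2 X"
  obtains B where "B > 0" "\<And>n. abs2 (X n) < B"
proof -
  obtain K where "K > 0" "\<And>n. norm (abs2 (X n)) \<le> K"
    using convergent_imp_Bseq[OF cauchy2_abs2_convergent[OF assms]] BseqE by metis
  then have le: "abs2 (X n) \<le> K" for n by simp
  have "abs2 (X n) < K + 1" for n using le[of n] by linarith
  then show thesis using that[of "K + 1"] \<open>K > 0\<close> by simp
qed

lemma cauchy2_mult:
  assumes "cauchy2 X" "cauchy2 Y"
  shows "cauchy2 (\<lambda>n. X n * Y n)"
  unfolding cauchy2_def
proof (intro allI impI)
  fix e :: real assume e: "e > 0"
  obtain B where B: "B > 0" "\<And>n. abs2 (X n) < B" by (metis cauchy2_bounded[OF assms(1)])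
  obtain C where C: "C > 0" "\<And>n. abs2 (Y n) < C" by (metis cauchy2_bounded[OF assms(2)])
  have "e / C > 0" "e / B > 0" using e B C by auto
  then obtain M N where M: "\<forall>m\<ge>M. \<forall>n\<ge>M. abs2 (X m - X n) < e / C"
    and N: "\<forall>m\<ge>N. \<forall>n\<ge>N. abs2 (Y m - Y n) < e / B"
    using assms unfolding cauchy2_def by metis
  have "abs2 (X m * Y m - X n * Y n) < e" if "m \<ge> max M N" "n \<ge> max M N" for m n
  proof -
    have x: "abs2 (X m - X n) < e / C" and y: "abs2 (Y m - Y n) < e / B" using M N that by auto
    have "abs2 (X m) * abs2 (Y m - Y n) \<le> B * abs2 (Y m - Y n)"
      using B(2)[of m] by (intro mult_right_mono) auto
    also have "\<dots> < B * (e / B)" using y B by (intro mult_strict_left_mono) auto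
    finally have 1: "abs2 (X m * (Y m - Y n)) < e" using B by (simp add: abs2_mult)
    have "abs2 (X m - X n) * abs2 (Y n) \<le> abs2 (X m - X n) * C"
      using C(2)[of n] by (intro mult_left_mono) auto
    also have "\<dots> < (e / C) * C" using x C by (intro mult_strict_right_mono) auto
    finally have 2: "abs2 ((X m - X n) * Y n) < e" using C by (simp add: abs2_mult)
    have "X m * Y m - X n * Y n = X m * (Y m - Y n) + (X m - X n) * Y n"
      by (simp add: algebra_simps)
    then show ?thesis using 1 2 abs2_add_max[of "X m * (Y m - Y n)" "(X m - X n) * Y n"] by simp
  qed
  then show "\<exists>N. \<forall>m\<ge>N. \<forall>n\<ge>N. abs2 (X m * Y m - X n * Y n) < e" by blast
qed

lemma vanishes2_mult:
  assumes "cauchy2 X" "vanishes2 Y"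
  shows "vanishes2 (\<lambda>n. X n * Y n)"
proof -
  obtain B where B: "B > 0" "\<And>n. abs2 (X n) < B" by (metis cauchy2_bounded[OF assms(1)])
  show ?thesis
  proof (rule vanishes2_bound)
    show "(\<lambda>n. B * abs2 (Y n)) \<longlonglongrightarrow> 0"
      using tendsto_mult_right_zero[OF assms(2)[unfolded vanishes2_def]] by simp
    show "eventually (\<lambda>n. abs2 (X n * Y n) \<le> B * abs2 (Y n)) sequentially"
      using B(2) by (intro always_eventually) (simp add: abs2_mult less_imp_le mult_right_mono)
  qed
qed

lemma cauchy2_not_vanishes2:
  assumes "cauchy2 X" "\<not> vanishes2 X"
  obtains b N where "b > 0" "\<And>n. n \<ge> N \<Longrightarrow> b < abs2 (X n)"
proof -
  obtain L where L: "(\<lambda>n. abs2 (X n)) \<longlonglongrightarrow> L"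
    using cauchy2_abs2_convergent[OF assms(1)] convergent_def by blast
  have "L \<ge> 0" by (rule LIMSEQ_le_const[OF L]) simp
  moreover have "L \<noteq> 0" using L assms(2) by (auto simp: vanishes2_def)
  ultimately have "L / 2 < L" "L / 2 > 0" by auto
  then show thesis
    using that order_tendstoD(1)[OF L, of "L / 2"] unfolding eventually_sequentially by blast
qed

lemma cauchy2_inverse:
  assumes "cauchy2 X" "\<not> vanishes2 X"
  shows "cauchy2 (\<lambda>n. inverse (X n))"
  unfolding cauchy2_def
proof (intro allI impI)
  fix e :: real assume e: "e > 0"
  obtain b M where b: "b > 0" "\<And>n. n \<ge> M \<Longrightarrow> b < abs2 (X n)"
    by (metis cauchy2_not_vanishes2[OF assms])
  have "e * (b * b) > 0" using e b by auto
  then obtain N where N: "\<forall>m\<ge>N. \<forall>n\<ge>N. abs2 (X m - X n) < e * (b * b)"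
    using assms(1) unfolding cauchy2_def by blast
  have "abs2 (inverse (X m) - inverse (X n)) < e" if mn: "m \<ge> max M N" "n \<ge> max M N" for m n
  proof -
    have m: "b < abs2 (X m)" and n: "b < abs2 (X n)" using b mn by auto
    then have nz: "X m \<noteq> 0" "X n \<noteq> 0" using b(1) by auto
    have "b * b \<le> abs2 (X m) * abs2 (X n)" using m n b(1) by (intro mult_mono) auto
    then have "e * (b * b) \<le> e * (abs2 (X m) * abs2 (X n))" using e by simp
    moreover have "abs2 (X m - X n) < e * (b * b)" using N mn by auto
    ultimately have lt: "abs2 (X m - X n) < e * (abs2 (X m) * abs2 (X n))" by linarith
    have "inverse (X m) - inverse (X n) = (X n - X m) * inverse (X m * X n)"
      using nz by (simp add: field_simps)
    then have "abs2 (inverse (X m) - inverse (X n)) = abs2 (X m - X n) / (abs2 (X m) * abs2 (X n))"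
      by (simp add: abs2_mult abs2_inverse abs2_minus_commute[of "X n"] divide_inverse)
    moreover have "abs2 (X m) * abs2 (X n) > 0" using m n b(1) by auto
    ultimately show ?thesis using lt by (simp add: pos_divide_less_eq)
  qed
  then show "\<exists>N. \<forall>m\<ge>N. \<forall>n\<ge>N. abs2 (inverse (X m) - inverse (X n)) < e" by blast
qed

lemma vanishes2_diff_inverse:
  assumes "cauchy2 X" "\<not> vanishes2 X" "cauchy2 Y" "\<not> vanishes2 Y" "vanishes2 (\<lambda>n. X n - Y n)"
  shows "vanishes2 (\<lambda>n. inverse (X n) - inverse (Y n))"
proof -
  obtain b M where b: "b > 0" "\<And>n. n \<ge> M \<Longrightarrow> b < abs2 (X n)"
    by (metis cauchy2_not_vanishes2[OF assms(1,2)])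
  obtain c N where c: "c > 0" "\<And>n. n \<ge> N \<Longrightarrow> c < abs2 (Y n)"
    by (metis cauchy2_not_vanishes2[OF assms(3,4)])
  have lim: "(\<lambda>n. abs2 (X n - Y n) * inverse (b * c)) \<longlonglongrightarrow> 0"
    using tendsto_mult_left_zero[OF assms(5)[unfolded vanishes2_def]] by simp
  have "abs2 (inverse (X n) - inverse (Y n)) \<le> abs2 (X n - Y n) * inverse (b * c)"
    if n: "n \<ge> max M N" for n
  proof -
    have x: "b < abs2 (X n)" and y: "c < abs2 (Y n)" using b c n by auto
    then have nz: "X n \<noteq> 0" "Y n \<noteq> 0" using b(1) c(1) by auto
    have "b * c \<le> abs2 (X n) * abs2 (Y n)" using x y b(1) c(1) by (intro mult_mono) auto
    then have le: "inverse (abs2 (X n) * abs2 (Y n)) \<le> inverse (b * c)"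
      using b(1) c(1) by (intro le_imp_inverse_le) auto
    have "inverse (X n) - inverse (Y n) = (Y n - X n) * inverse (X n * Y n)"
      using nz by (simp add: field_simps)
    then have "abs2 (inverse (X n) - inverse (Y n)) = abs2 (X n - Y n) * inverse (abs2 (X n) * abs2 (Y n))"
      by (simp add: abs2_mult abs2_inverse abs2_minus_commute[of "Y n"])
    then show ?thesis using le by (simp add: mult_left_mono)
  qed
  then have "eventually (\<lambda>n. abs2 (inverse (X n) - inverse (Y n)) \<le> abs2 (X n - Y n) * inverse (b * c)) sequentially"
    unfolding eventually_sequentially by blast
  with lim show ?thesis by (rule vanishes2_bound)
qed

definition q2rel :: "(nat \<Rightarrow> rat) \<Rightarrow> (nat \<Rightarrow> rat) \<Rightarrow> bool" where
  "q2rel X Y \<longleftrightarrow> cauchy2 X \<and> cauchy2 Y \<and> vanishes2 (\<lambda>n. X n - Y n)"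

lemma q2rel_refl: "cauchy2 X \<Longrightarrow> q2rel X X"
  by (simp add: q2rel_def)

lemma part_equivp_q2rel: "part_equivp q2rel"
proof (rule part_equivpI)
  show "\<exists>X. q2rel X X" using q2rel_refl cauchy2_const by blast
  show "symp q2rel"
  proof (rule sympI)
    fix X Y assume "q2rel X Y"
    then show "q2rel Y X"
      using vanishes2_minus[of "\<lambda>n. X n - Y n"] by (simp add: q2rel_def)
  qed
  show "transp q2rel"
  proof (rule transpI)
    fix X Y Z assume "q2rel X Y" "q2rel Y Z"
    then show "q2rel X Z"
      using vanishes2_add[of "\<lambda>n. X n - Y n" "\<lambda>n. Y n - Z n"] by (simp add: q2rel_def)
  qed
qed

quotient_type q2 = "nat \<Rightarrow> rat" / partial: q2rel
  by (rule part_equivp_q2rel)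

instantiation q2 :: field
begin

lift_definition zero_q2 :: q2 is "\<lambda>n. 0"
  by (simp add: q2rel_refl)

lift_definition one_q2 :: q2 is "\<lambda>n. 1"
  by (simp add: q2rel_refl)

lift_definition plus_q2 :: "q2 \<Rightarrow> q2 \<Rightarrow> q2" is "\<lambda>X Y n. X n + Y n"
  unfolding q2rel_def add_diff_add by (simp add: cauchy2_add vanishes2_add)

lift_definition uminus_q2 :: "q2 \<Rightarrow> q2" is "\<lambda>X n. - X n"
  unfolding q2rel_def minus_diff_minus by (simp only: cauchy2_minus vanishes2_minus simp_thms)

lift_definition times_q2 :: "q2 \<Rightarrow> q2 \<Rightarrow> q2" is "\<lambda>X Y n. X n * Y n"
proof -
  fix f1 f2 f3 f4
  assume *: "q2rel f1 f2" "q2rel f3 f4"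
  then have "vanishes2 (\<lambda>n. f1 n * (f3 n - f4 n) + f4 n * (f1 n - f2 n))"
    by (simp add: q2rel_def vanishes2_add vanishes2_mult)
  then show "q2rel (\<lambda>n. f1 n * f3 n) (\<lambda>n. f2 n * f4 n)"
    using * unfolding q2rel_def mult_diff_mult by (simp add: cauchy2_mult mult.commute)
qed

lift_definition inverse_q2 :: "q2 \<Rightarrow> q2"
  is "\<lambda>X. if vanishes2 X then (\<lambda>n. 0) else (\<lambda>n. inverse (X n))"
proof -
  fix X Y
  assume "q2rel X Y"
  then have *: "cauchy2 X" "cauchy2 Y" "vanishes2 (\<lambda>n. X n - Y n)"
    by (simp_all add: q2rel_def)
  have "vanishes2 X \<longleftrightarrow> vanishes2 Y"
    using vanishes2_diff[OF _ *(3), of X] vanishes2_add[OF _ *(3), of Y] by auto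
  then show "?thesis X Y"
    using * by (auto simp: q2rel_def cauchy2_inverse vanishes2_diff_inverse)
qed

definition "x - y = x + - y" for x y :: q2

definition "x div y = x * inverse y" for x y :: q2

instance
proof
  fix a b c :: q2
  show "a + b = b + a" by transfer (simp add: add.commute q2rel_def cauchy2_add)
  show "(a + b) + c = a + (b + c)" by transfer (simp add: add.assoc q2rel_def cauchy2_add)
  show "0 + a = a" by transfer (simp add: q2rel_def)
  show "- a + a = 0" by transfer (simp add: q2rel_def)
  show "a - b = a + - b" by (rule minus_q2_def)
  show "(a * b) * c = a * (b * c)" by transfer (simp add: mult.assoc q2rel_def cauchy2_mult)
  show "a * b = b * a" by transfer (simp add: mult.commute q2rel_def cauchy2_mult)
  show "1 * a = a" by transfer (simp add: q2rel_def)
  show "(a + b) * c = a * c + b * c"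
    by transfer (simp add: distrib_right q2rel_def cauchy2_mult cauchy2_add)
  show "(0::q2) \<noteq> 1" by transfer (simp add: q2rel_def vanishes2_minus)
  show "a \<noteq> 0 \<Longrightarrow> inverse a * a = 1"
  proof transfer
    fix X assume "q2rel X X" and "\<not> q2rel X (\<lambda>n. 0)"
    then have X: "cauchy2 X" "\<not> vanishes2 X" by (auto simp: q2rel_def)
    obtain b N where b: "b > 0" "\<And>n. n \<ge> N \<Longrightarrow> b < abs2 (X n)"
      by (metis cauchy2_not_vanishes2[OF X])
    have "eventually (\<lambda>n. abs2 (inverse (X n) * X n - 1) = 0) sequentially"
      unfolding eventually_sequentially
    proof (intro exI[of _ N] allI impI)
      fix n assume "n \<ge> N"
      then have "X n \<noteq> 0" using b(1) b(2)[of n] by auto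
      then show "abs2 (inverse (X n) * X n - 1) = 0" by simp
    qed
    then have "vanishes2 (\<lambda>n. inverse (X n) * X n - 1)"
      unfolding vanishes2_def by (rule tendsto_eventually)
    then show "q2rel (\<lambda>n. (if vanishes2 X then \<lambda>n. 0 else (\<lambda>n. inverse (X n))) n * X n) (\<lambda>n. 1)"
      using X by (simp add: q2rel_def cauchy2_mult cauchy2_inverse)
  qed
  show "a div b = a * inverse b" by (rule divide_q2_def)
  show "inverse (0::q2) = 0" by transfer (simp add: q2rel_refl)
qed

end

text \<open>The extension of \<^const>\<open>abs2\<close> to \<^typ>\<open>q2\<close>, with |2| = 1/2.  The class constant \<open>norm\<close> is not
  available because its type is constrained to real vector spaces.\<close>

lift_definition norm2 :: "q2 \<Rightarrow> real" is "\<lambda>X. lim (\<lambda>n. abs2 (X n))"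
proof -
  fix X Y assume "q2rel X Y"
  then have *: "cauchy2 X" "cauchy2 Y" "vanishes2 (\<lambda>n. X n - Y n)"
    by (simp_all add: q2rel_def)
  have "(\<lambda>n. abs2 (X n) - abs2 (Y n)) \<longlonglongrightarrow> 0"
    by (rule Lim_null_comparison[OF _ *(3)[unfolded vanishes2_def]]) (simp add: abs2_abs_diff)
  moreover have "(\<lambda>n. abs2 (Y n)) \<longlonglongrightarrow> lim (\<lambda>n. abs2 (Y n))"
    using cauchy2_abs2_convergent[OF *(2)] by (simp add: convergent_LIMSEQ_iff)
  ultimately have "(\<lambda>n. abs2 (X n)) \<longlonglongrightarrow> lim (\<lambda>n. abs2 (Y n))"
    using tendsto_add[of "\<lambda>n. abs2 (X n) - abs2 (Y n)" 0 sequentially] by fastforce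
  then show "lim (\<lambda>n. abs2 (X n)) = lim (\<lambda>n. abs2 (Y n))" by (rule limI)
qed

lemma norm2_tendsto: "q2rel X X \<Longrightarrow> (\<lambda>n. abs2 (X n)) \<longlonglongrightarrow> lim (\<lambda>n. abs2 (X n))"
  unfolding q2rel_def using cauchy2_abs2_convergent convergent_LIMSEQ_iff by blast

lemma norm2_eq_0: "norm2 x = 0 \<longleftrightarrow> x = 0" for x :: q2
proof transfer
  fix X assume X: "q2rel X X"
  show "lim (\<lambda>n. abs2 (X n)) = 0 \<longleftrightarrow> q2rel X (\<lambda>n. 0)"
  proof
    assume "lim (\<lambda>n. abs2 (X n)) = 0"
    then show "q2rel X (\<lambda>n. 0)"
      using norm2_tendsto[OF X] X by (simp add: q2rel_def vanishes2_def)
  next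
    assume "q2rel X (\<lambda>n. 0)"
    then have "(\<lambda>n. abs2 (X n)) \<longlonglongrightarrow> 0" by (simp add: q2rel_def vanishes2_def)
    then show "lim (\<lambda>n. abs2 (X n)) = 0" by (rule limI)
  qed
qed

lemma norm2_minus: "norm2 (- x) = norm2 x" for x :: q2
  by transfer simp

lemma norm2_add_max: "norm2 (x + y) \<le> max (norm2 x) (norm2 y)" for x y :: q2
proof transfer
  fix X Y assume X: "q2rel X X" and Y: "q2rel Y Y"
  then have "q2rel (\<lambda>n. X n + Y n) (\<lambda>n. X n + Y n)" by (simp add: q2rel_def cauchy2_add)
  from norm2_tendsto[OF this] tendsto_max[OF norm2_tendsto[OF X] norm2_tendsto[OF Y]]
  show "lim (\<lambda>n. abs2 (X n + Y n)) \<le> max (lim (\<lambda>n. abs2 (X n))) (lim (\<lambda>n. abs2 (Y n)))"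
    by (rule LIMSEQ_le) (simp add: abs2_add_max)
qed

lemma norm2_nonneg: "0 \<le> norm2 x" for x :: q2
proof transfer
  fix X assume "q2rel X X"
  from norm2_tendsto[OF this] show "0 \<le> lim (\<lambda>n. abs2 (X n))"
    by (rule LIMSEQ_le_const) simp
qed

instantiation q2 :: metric_space
begin

definition dist_q2 :: "q2 \<Rightarrow> q2 \<Rightarrow> real" where
  "dist x y = norm2 (x - y)" for x y :: q2

definition uniformity_q2 :: "(q2 \<times> q2) filter" where
  "uniformity = (INF e\<in>{0 <..}. principal {(x :: q2, y). dist x y < e})"

definition open_q2 :: "q2 set \<Rightarrow> bool" where
  "open U \<longleftrightarrow> (\<forall>x\<in>U. eventually (\<lambda>(x', y). x' = x \<longrightarrow> y \<in> U) uniformity)" for U :: "q2 set"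

instance
proof
  fix x y z :: q2
  show "dist x y = 0 \<longleftrightarrow> x = y" by (simp add: dist_q2_def norm2_eq_0)
  have "norm2 (x - y) \<le> max (norm2 (x - z)) (norm2 (y - z))"
    using norm2_add_max[of "x - z" "z - y"] norm2_minus[of "y - z"] by simp
  then show "dist x y \<le> dist x z + dist y z"
    using norm2_nonneg[of "x - z"] norm2_nonneg[of "y - z"] by (simp add: dist_q2_def)
qed (simp_all add: uniformity_q2_def open_q2_def)

end

lemma norm2_mult: "norm2 (x * y) = norm2 x * norm2 y" for x y :: q2
proof transfer
  fix X Y assume X: "q2rel X X" and Y: "q2rel Y Y"
  from tendsto_mult[OF norm2_tendsto[OF X] norm2_tendsto[OF Y]]
  show "lim (\<lambda>n. abs2 (X n * Y n)) = lim (\<lambda>n. abs2 (X n)) * lim (\<lambda>n. abs2 (Y n))"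
    by (simp add: abs2_mult limI)
qed

lemma norm2_two: "norm2 (2 :: q2) = 1 / 2"
proof -
  have "abs2 2 = 1 / 2" by (simp add: abs2_def power_int_minus)
  moreover have "norm2 (1 + 1 :: q2) = abs2 (1 + 1)" by transfer simp
  ultimately show ?thesis by (simp only: one_add_one)
qed

section \<open>Fractional part and additive character\<close>

text \<open>
  \<open>frac2 t\<close> is the part of the 2-adic digit expansion of \<open>t\<close> with negative powers of 2, read as a
  real number.  Padding with leading zero digits is permitted, so \<open>m\<close> can be any natural
  number large enough for \<open>t\<close>.
\<close>

definition frac2 :: "q2 \<Rightarrow> real" where
  "frac2 t = (THE r. \<exists>m::nat. \<exists>d::nat \<Rightarrow> nat. (\<forall>k. d k \<in> {0, 1}) \<and>
      (\<lambda>k. of_nat (d k) * 2 powi (int k - int m)) sums t \<and>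
      r = (\<Sum>k<m. real (d k) * 2 powi (int k - int m)))"

definition chi2 :: "q2 \<Rightarrow> complex" where
  "chi2 t = exp (2 * of_real pi * \<i> * of_real (frac2 t))"


section \<open>Haar measure\<close>

text \<open>The Haar measure on the additive group of \<^typ>\<open>q2\<close> giving the ring of 2-adic integers mass 1.\<close>

definition haar2 :: "q2 measure" where
  "haar2 = (THE M. sets M = sets borel \<and>
      (\<forall>c. \<forall>A\<in>sets borel. emeasure M ((+) c ` A) = emeasure M A) \<and>
      emeasure M {x. norm2 x \<le> 1} = 1)"

text \<open>
  \<open>Pi\<^sub>M\<close> lives on functions; it is transported to the vector type along the bijection
  \<^term>\<open>vec_lambda\<close>.
\<close>

definition haar2_vec :: "(q2 ^ 'n::finite) measure" where
  "haar2_vec = distr (\<Pi>\<^sub>M i\<in>UNIV. haar2) borel vec_lambda"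


section \<open>Vectors over the 2-adic numbers\<close>

definition norm2_vec :: "q2 ^ 'n::finite \<Rightarrow> real" where
  "norm2_vec x = Max (range (\<lambda>i. norm2 (x $ i)))"

definition dot2 :: "q2 ^ 'n::finite \<Rightarrow> q2 ^ 'n \<Rightarrow> q2" where
  "dot2 x y = (\<Sum>i\<in>UNIV. x $ i * y $ i)"

definition I2 :: "q2 set" where
  "I2 = {2 powi (- int m) * (\<Sum>i<m. of_nat (a i) * 2 ^ i) | m (a :: nat \<Rightarrow> nat). \<forall>i. a i \<in> {0, 1}}"

definition I2_vec :: "(q2 ^ 'n::finite) set" where
  "I2_vec = {a. \<forall>i. a $ i \<in> I2}"


section \<open>Lizorkin space, Fourier transform, Taibleson operator\<close>

definition test_functions2 :: "(q2 ^ 'n::finite \<Rightarrow> complex) set" where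
  "test_functions2 = {f. (\<forall>x. \<forall>\<^sub>F y in nhds x. f y = f x) \<and> compact (closure {x. f x \<noteq> 0})}"

definition lizorkin2 :: "(q2 ^ 'n::finite \<Rightarrow> complex) set" where
  "lizorkin2 = {f \<in> test_functions2. (LINT x|haar2_vec. f x) = 0}"

definition fourier2 :: "(q2 ^ 'n::finite \<Rightarrow> complex) \<Rightarrow> q2 ^ 'n \<Rightarrow> complex" where
  "fourier2 f \<xi> = (LINT x|haar2_vec. chi2 (dot2 \<xi> x) * f x)"

definition inv_fourier2 :: "(q2 ^ 'n::finite \<Rightarrow> complex) \<Rightarrow> q2 ^ 'n \<Rightarrow> complex" where
  "inv_fourier2 g x = (LINT \<xi>|haar2_vec. chi2 (- dot2 x \<xi>) * g \<xi>)"

definition taibleson2 :: "complex \<Rightarrow> (q2 ^ 'n::finite \<Rightarrow> complex) \<Rightarrow> q2 ^ 'n \<Rightarrow> complex" where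
  "taibleson2 \<alpha> f = inv_fourier2
     (\<lambda>\<xi>. if \<xi> = 0 then 0 else of_real (norm2_vec \<xi>) powr \<alpha> * fourier2 f \<xi>)"

text \<open>
  The function \<^const>\<open>taibleson2\<close> is total; as an operator its domain is \<^const>\<open>lizorkin2\<close>, so
  membership in that space is part of being an eigenfunction.
\<close>

definition taibleson2_eigenfunction ::
    "complex \<Rightarrow> complex \<Rightarrow> (q2 ^ 'n::finite \<Rightarrow> complex) \<Rightarrow> bool" where
  "taibleson2_eigenfunction \<alpha> c f \<longleftrightarrow>
     f \<in> lizorkin2 \<and> f \<noteq> (\<lambda>_. 0) \<and> taibleson2 \<alpha> f = (\<lambda>x. c * f x)"


section \<open>The multidimensional 2-adic Haar wavelets\<close>

definition Omega :: "real \<Rightarrow> real" where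
  "Omega t = (if 0 \<le> t \<and> t \<le> 1 then 1 else 0)"

definition k_vec :: "'n set \<Rightarrow> q2 ^ 'n::finite" where
  "k_vec e = (\<chi> i. if i \<in> e then 1 else 0)"

definition Psi0 :: "'n set \<Rightarrow> int \<Rightarrow> q2 ^ 'n \<Rightarrow> q2 ^ 'n::finite \<Rightarrow> complex" where
  "Psi0 e j a x =
     of_real (2 powr (- real CARD('n) * of_int j / 2)) *
     chi2 (inverse 2 * dot2 (k_vec e) (2 powi j *s x - a)) *
     of_real (Omega (norm2_vec (2 powi j *s x - a)))"

end

theory Submission
  imports Defs
begin

text \<open>
  The wavelet is a product over the coordinates of one-dimensional waves
  \<open>x \<mapsto> \<chi>(h(2\<^sup>jx - a)) \<Omega>(|2\<^sup>jx - a|)\<close> with \<open>h \<in> {0, 1/2}\<close>.  Since the integral of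
  \<open>\<chi>(cx)\<close> over a ball vanishes as soon as \<open>\<chi>(cx)\<close> is not constant there, the Fourier transform of
  a wave is a multiple of the wave with the roles of \<open>h\<close> and \<open>a\<close> exchanged and \<open>j\<close> replaced by
  \<open>-j\<close>; this also gives Fourier inversion for waves.  A coordinate with \<open>h = 1/2\<close> forces
  \<open>|\<xi>| = 2\<^sup>1\<^sup>-\<^sup>j\<close> on the support of the transform, so the symbol acts there as a constant.
  Haar measure is the image of Lebesgue measure on the half-line under reversal of the binary digits,
  which matches dyadic intervals with 2-adic balls of the same measure.
\<close>

section \<open>Rational numbers inside the 2-adic numbers\<close>

lift_definition q2_of_rat :: "rat \<Rightarrow> q2" is "\<lambda>r n. r"
  by (simp add: q2rel_refl)

lemma norm2_q2_of_rat [simp]: "norm2 (q2_of_rat r) = abs2 r"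
  by transfer simp

lemma q2_of_rat_0 [simp]: "q2_of_rat 0 = 0"
  by transfer (simp add: q2rel_refl)

lemma q2_of_rat_1 [simp]: "q2_of_rat 1 = 1"
  by transfer (simp add: q2rel_refl)

lemma q2_of_rat_diff: "q2_of_rat (r - s) = q2_of_rat r - q2_of_rat s"
  unfolding minus_q2_def by transfer (simp add: q2rel_refl)

lemma q2_of_rat_add: "q2_of_rat (r + s) = q2_of_rat r + q2_of_rat s"
  by transfer (simp add: q2rel_refl)

lemma q2_of_rat_of_nat: "q2_of_rat (of_nat n) = of_nat n"
  by (induction n) (simp_all add: q2_of_rat_add)

lemma q2_of_rat_of_int: "q2_of_rat (of_int n) = of_int n"
proof (cases n rule: int_diff_cases)
  case (diff a b)
  then show ?thesis by (simp add: q2_of_rat_of_nat q2_of_rat_diff)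
qed

section \<open>Ultrametric estimates and multiplicativity of the norm\<close>

lemma norm2_0 [simp]: "norm2 0 = 0"
  using norm2_eq_0 by blast

lemma norm2_1 [simp]: "norm2 1 = 1"
  by (metis norm2_q2_of_rat q2_of_rat_1 abs2_1)

lemma norm2_of_int: "norm2 (of_int n) = abs2 (of_int n)"
  by (metis norm2_q2_of_rat q2_of_rat_of_int)

lemma norm2_diff_max: "norm2 (x - y) \<le> max (norm2 x) (norm2 y)"
  using norm2_add_max[of x "- y"] by (simp add: norm2_minus)

lemma norm2_minus_commute: "norm2 (x - y) = norm2 (y - x)"
  using norm2_minus[of "x - y"] by simp

lemma norm2_diff_le_trans:
  assumes "norm2 (x - y) \<le> r" "norm2 (y - z) \<le> r"
  shows "norm2 (x - z) \<le> r"
  using norm2_add_max[of "x - y" "y - z"] assms by auto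

text \<open>The isosceles principle of ultrametric spaces. It transfers exact norms, first from a
  nearby rational to a 2-adic number, later from \<open>1 / 2\<close> to a frequency
  coordinate.\<close>

lemma norm2_eqI:
  assumes "norm2 (x - y) < norm2 x"
  shows "norm2 y = norm2 x"
proof (rule antisym)
  show "norm2 y \<le> norm2 x"
    using norm2_diff_max[of x "x - y"] assms by auto
  show "norm2 x \<le> norm2 y"
    using norm2_add_max[of "x - y" y] assms by auto
qed

lemma norm2_inverse: "norm2 (inverse x) = inverse (norm2 x)"
proof (cases "x = 0")
  case False
  then have "norm2 x * norm2 (inverse x) = 1" by (simp add: norm2_mult [symmetric])
  then show ?thesis by (metis inverse_unique)
qed auto

lemma norm2_divide: "norm2 (x / y) = norm2 x / norm2 y"
  by (simp add: divide_inverse norm2_mult norm2_inverse)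

lemma norm2_power: "norm2 (x ^ k) = norm2 x ^ k"
  by (induction k) (simp_all add: norm2_mult)

lemma norm2_power_int: "norm2 (x powi k) = norm2 x powi k"
  by (simp add: power_int_def norm2_power norm2_inverse)

lemma norm2_two_powi [simp]: "norm2 (2 powi k) = 2 powi (- k)"
  by (simp add: norm2_power_int norm2_two power_int_minus_divide power_int_divide_distrib)

lemma norm2_two_power [simp]: "norm2 (2 ^ k) = (1 / 2) ^ k"
  by (simp add: norm2_power norm2_two)

lemma norm2_half: "norm2 (x / 2) = 2 * norm2 x"
  by (simp add: norm2_divide norm2_two)

lemma q2_two_neq_0 [simp]: "(2 :: q2) \<noteq> 0"
  using norm2_two norm2_0 by fastforce

text \<open>Links the quotient construction to the metric: a representing sequence converges to its
  own class. Density of the rationals follows, and most later arguments use only that.\<close>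

lemma q2_of_rat_approximates:
  assumes "cauchy2 X"
  shows "(\<lambda>n. norm2 (abs_q2 X - q2_of_rat (X n))) \<longlonglongrightarrow> 0"
proof (rule LIMSEQ_I)
  fix e :: real assume "e > 0"
  \<comment> \<open>A strict bound becomes weak in the limit over the first index, so
    \<open>e / 2\<close> is what leaves a strict bound by \<open>e\<close> at the end.\<close>
  then obtain N where N: "\<forall>m\<ge>N. \<forall>n\<ge>N. abs2 (X m - X n) < e / 2"
    using assms unfolding cauchy2_def by (meson half_gt_zero)
  have "norm2 (abs_q2 X - q2_of_rat (X n)) \<le> e / 2" if "n \<ge> N" for n
  proof -
    have X: "q2rel X X" using assms by (rule q2rel_refl)
    have c: "cauchy2 (\<lambda>k. X k - X n)" using cauchy2_add[OF assms cauchy2_const[of "- X n"]] by simp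
    have "abs_q2 X - q2_of_rat (X n) = abs_q2 (\<lambda>k. X k - X n)"
      unfolding minus_q2_def using X
      by (simp add: q2_of_rat.abs_eq uminus_q2.abs_eq plus_q2.abs_eq q2rel_refl)
    then have "norm2 (abs_q2 X - q2_of_rat (X n)) = lim (\<lambda>k. abs2 (X k - X n))"
      using c by (simp add: norm2.abs_eq q2rel_refl)
    moreover have "lim (\<lambda>k. abs2 (X k - X n)) \<le> e / 2"
      using norm2_tendsto[OF q2rel_refl[OF c]]
      by (rule LIMSEQ_le_const2) (use N that in \<open>blast intro: less_imp_le\<close>)
    ultimately show ?thesis by simp
  qed
  then show "\<exists>N. \<forall>n\<ge>N. norm (norm2 (abs_q2 X - q2_of_rat (X n)) - 0) < e"
    using \<open>e > 0\<close> norm2_nonneg by (intro exI[of _ N]) fastforce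
qed

lemma q2_of_rat_dense:
  assumes "e > 0"
  obtains r where "norm2 (x - q2_of_rat r) < e"
proof -
  have "\<exists>X. x = abs_q2 X \<and> cauchy2 X"
    by (rule q2.abs_induct) (auto simp: q2rel_def)
  then obtain X where X: "x = abs_q2 X" "cauchy2 X" by blast
  from order_tendstoD(2)[OF q2_of_rat_approximates[OF X(2)] assms] that X(1)
  show thesis by (auto simp: eventually_sequentially)
qed

text \<open>A rational closer to \<open>x\<close> than \<open>norm2 x\<close> has the same norm, and
  norms of nonzero rationals are powers of two by definition.\<close>

lemma norm2_value:
  assumes "x \<noteq> 0"
  obtains k where "norm2 x = 2 powi k"
proof -
  have "norm2 x > 0" using assms norm2_nonneg norm2_eq_0 by (metis less_eq_real_def)
  then obtain r where r: "norm2 (x - q2_of_rat r) < norm2 x" by (rule q2_of_rat_dense)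
  then have "norm2 x = abs2 r" using norm2_eqI[OF r] by simp
  moreover have "r \<noteq> 0" using r by auto
  ultimately show thesis using that by (auto simp: abs2_def)
qed

section \<open>Norms of integers, divisibility by powers of two, and residues\<close>

lemma two_powi_less_iff [simp]: "(2::real) powi i < 2 powi j \<longleftrightarrow> i < j"
  by (meson linorder_not_less one_le_numeral one_less_numeral_iff power_int_increasing
      power_int_strict_increasing semiring_norm(76))

lemma two_powi_le_iff [simp]: "(2::real) powi i \<le> 2 powi j \<longleftrightarrow> i \<le> j"
  by (meson linorder_not_less two_powi_less_iff)

lemma abs2_of_int_le:
  "abs2 (of_int n) \<le> (1 / 2) ^ k \<longleftrightarrow> 2 ^ k dvd n"
proof (cases "n = 0")
  case False
  have "abs2 (of_int n) = 2 powi (- int (multiplicity 2 n))"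
    using abs2_Fract[of n 1] False by (simp add: Fract_of_int_eq)
  moreover have "(1/2::real) ^ k = 2 powi (- int k)"
    by (simp add: power_int_minus power_one_over field_simps)
  ultimately have "abs2 (of_int n) \<le> (1 / 2) ^ k \<longleftrightarrow> k \<le> multiplicity 2 n" by simp
  then show ?thesis using False
    by (metis multiplicity_geI multiplicity_dvd' not_is_unit_0 odd_one)
qed auto

lemma norm2_of_int_le: "norm2 (of_int n) \<le> (1 / 2) ^ k \<longleftrightarrow> 2 ^ k dvd n"
  by (simp add: norm2_of_int abs2_of_int_le)

lemma norm2_of_int_le_1: "norm2 (of_int n) \<le> 1"
  using norm2_of_int_le[of n 0] by simp

text \<open>The residue field has two elements. A nearby fraction \<open>p / q\<close> in lowest
  terms has odd \<open>q\<close>, so it is congruent to \<open>p\<close> modulo 2, and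
  \<open>b\<close> is the parity of \<open>p\<close>. Every digit extraction below rests on
  this.\<close>

lemma q2_residue:
  assumes "norm2 x \<le> 1"
  obtains b :: nat where "b \<in> {0, 1}" "norm2 (x - of_nat b) \<le> 1 / 2"
proof -
  obtain r where r: "norm2 (x - q2_of_rat r) < 1 / 2"
    using q2_of_rat_dense[of "1/2" x] by auto
  then have r1: "abs2 r \<le> 1"
    using norm2_diff_max[of x "x - q2_of_rat r"] assms by auto
  obtain p q where pq: "r = Fract p q" "q > 0" "coprime p q" by (cases r)
  have nz: "abs2 (Fract m q) = abs2 (of_int m) / abs2 (of_int q)" for m
    by (simp add: Fract_of_int_quotient divide_inverse abs2_mult abs2_inverse)
  have h: "abs2 (of_int m) \<le> 1 / 2 \<longleftrightarrow> even m" for m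
    using abs2_of_int_le[of m 1] by simp
  \<comment> \<open>For even \<open>q\<close>, coprimality makes \<open>p\<close> odd; then
    \<open>p\<close> has larger norm than \<open>q\<close>, against
    \<open>abs2 r \<le> 1\<close>.\<close>
  have "odd q"
  proof
    assume "even q"
    then have "odd p" using pq(3) coprime_common_divisor by fastforce
    then have "abs2 (of_int p) > 1 / 2" using h[of p] by auto
    moreover have "abs2 (of_int p) \<le> abs2 (of_int q)"
      using r1 pq nz[of p] by (simp add: field_simps abs2_eq_0 less_le)
    ultimately show False using \<open>even q\<close> h[of q] by auto
  qed
  have q1: "abs2 (of_int q) = 1"
  proof -
    have "multiplicity 2 q = 0" using \<open>odd q\<close> by (rule not_dvd_imp_multiplicity_0)
    then show ?thesis using abs2_Fract[of q 1] pq(2) by (simp add: Fract_of_int_eq)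
  qed
  obtain b :: nat where b: "b \<in> {0, 1}" "even (p - int b * q)"
  proof (cases "even p")
    case True
    then show ?thesis using that[of 0] by simp
  next
    case False
    then show ?thesis using that[of 1] \<open>odd q\<close> by simp
  qed
  have "abs2 (r - of_nat b) \<le> 1 / 2"
  proof -
    have "r - of_nat b = Fract (p - int b * q) q"
      using pq by (simp add: Fract_of_int_quotient field_simps)
    then show ?thesis using h[of "p - int b * q"] b(2) nz[of "p - int b * q"] q1 by (simp only: div_by_1)
  qed
  then have "norm2 (q2_of_rat r - of_nat b) \<le> 1 / 2"
    by (metis norm2_q2_of_rat q2_of_rat_diff q2_of_rat_of_nat)
  then show thesis
    using that[OF b(1)] norm2_diff_le_trans[of x "q2_of_rat r" "1/2"] r by simp
qed

section \<open>Topology of the 2-adic numbers\<close>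

text \<open>Diagonal argument: rationals \<open>r n\<close> within \<open>(1/2) ^ n\<close> of
  \<open>X n\<close> form a Cauchy sequence, and its class in the quotient is the limit.\<close>

instance q2 :: complete_space
proof
  fix X :: "nat \<Rightarrow> q2" assume X: "Cauchy X"
  have "\<exists>r. norm2 (X n - q2_of_rat r) < (1/2) ^ n" for n
    by (rule q2_of_rat_dense[of "(1/2) ^ n" "X n"]) auto
  then obtain r where r: "\<And>n. norm2 (X n - q2_of_rat (r n)) < (1/2) ^ n" by metis
  have r0: "(\<lambda>n. norm2 (X n - q2_of_rat (r n))) \<longlonglongrightarrow> 0"
    by (rule Lim_null_comparison[OF _ LIMSEQ_power_zero[of "1/2::real"]])
       (use r norm2_nonneg in \<open>auto intro!: always_eventually less_imp_le\<close>)
  have "cauchy2 r" unfolding cauchy2_def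
  proof (intro allI impI)
    fix e :: real assume e: "e > 0"
    obtain M where M: "\<forall>m\<ge>M. \<forall>n\<ge>M. norm2 (X m - X n) < e"
      using X e unfolding Cauchy_def dist_q2_def by blast
    obtain N where N: "\<forall>n\<ge>N. norm2 (X n - q2_of_rat (r n)) < e"
      using order_tendstoD(2)[OF r0 e] by (auto simp: eventually_sequentially)
    have "abs2 (r m - r n) < e" if mn: "m \<ge> max M N" "n \<ge> max M N" for m n
    proof -
      have "norm2 (q2_of_rat (r m) - X m) < e" "norm2 (X m - X n) < e"
        "norm2 (X n - q2_of_rat (r n)) < e"
        using M N mn by (auto simp: norm2_minus_commute[of _ "X m"])
      moreover have "q2_of_rat (r m - r n) =
          (q2_of_rat (r m) - X m) + ((X m - X n) + (X n - q2_of_rat (r n)))"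
        by (simp add: q2_of_rat_diff)
      ultimately show ?thesis
        using norm2_add_max[of "q2_of_rat (r m) - X m" "(X m - X n) + (X n - q2_of_rat (r n))"]
          norm2_add_max[of "X m - X n" "X n - q2_of_rat (r n)"]
        by (simp flip: norm2_q2_of_rat)
    qed
    then show "\<exists>N. \<forall>m\<ge>N. \<forall>n\<ge>N. abs2 (r m - r n) < e" by blast
  qed
  from tendsto_max[OF r0 q2_of_rat_approximates[OF this]]
  have "(\<lambda>n. max (norm2 (X n - q2_of_rat (r n))) (norm2 (abs_q2 r - q2_of_rat (r n)))) \<longlonglongrightarrow> 0"
    by simp
  then have "(\<lambda>n. dist (X n) (abs_q2 r)) \<longlonglongrightarrow> 0"
  proof (rule Lim_null_comparison[rotated], intro always_eventually allI)
    fix n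
    show "norm (dist (X n) (abs_q2 r)) \<le>
      max (norm2 (X n - q2_of_rat (r n))) (norm2 (abs_q2 r - q2_of_rat (r n)))"
      using norm2_diff_max[of "X n - q2_of_rat (r n)" "abs_q2 r - q2_of_rat (r n)"]
      by (simp add: dist_q2_def norm2_nonneg)
  qed
  then show "convergent X" using tendsto_dist_iff convergent_def by blast
qed

section \<open>Balls and compactness\<close>

lemma mem_cball_q2: "x \<in> cball c r \<longleftrightarrow> norm2 (x - c) \<le> r" for x :: q2
  by (simp add: dist_q2_def norm2_minus_commute)

text \<open>By the ultrametric inequality, being within distance \<open>r\<close> is an equivalence
  relation; its classes are the balls, so any point serves as centre.\<close>

lemma cball_q2_eq:
  fixes c :: q2
  assumes "c' \<in> cball c r"
  shows "cball c' r = cball c r"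
proof -
  have "norm2 (c' - c) \<le> r" "norm2 (c - c') \<le> r"
    using assms unfolding mem_cball_q2 by (simp_all add: norm2_minus_commute)
  then show ?thesis unfolding set_eq_iff mem_cball_q2
    using norm2_diff_le_trans by blast
qed

lemma open_cball_q2:
  fixes c :: q2
  assumes "r > 0"
  shows "open (cball c r)"
  unfolding open_contains_ball
proof
  fix x assume "x \<in> cball c r"
  then have "cball x r = cball c r" by (rule cball_q2_eq)
  then show "\<exists>e>0. ball x e \<subseteq> cball c r" using assms ball_subset_cball by blast
qed

text \<open>Scaling by \<open>2 powi k\<close> turns the ball into a coset of the 2-adic integers,
  and the two halves are its two residue classes modulo 2. Iterated, this yields finite covers; for
  an invariant measure it yields halving of mass.\<close>

lemma cball_q2_halve:
  fixes c :: q2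
  shows "cball c (2 powi k) = cball c (2 powi (k - 1)) \<union> cball (c + 2 powi (- k)) (2 powi (k - 1))"
    (is "?L = ?R")
    and "cball c (2 powi (k - 1)) \<inter> cball (c + 2 powi (- k)) (2 powi (k - 1)) = {}"
proof -
  have le: "2 powi (k - 1) \<le> (2 powi k :: real)" by simp
  show "?L = ?R"
  proof (intro equalityI subsetI)
    fix x assume "x \<in> ?L"
    then have "norm2 (x - c) \<le> 2 powi k" by (simp only: mem_cball_q2)
    then have "2 powi (- k) * norm2 (x - c) \<le> 1"
      by (simp add: power_int_minus field_simps)
    then have "norm2 (2 powi k * (x - c)) \<le> 1"
      by (simp only: norm2_mult norm2_two_powi)
    then obtain b :: nat where b: "b \<in> {0, 1}" "norm2 (2 powi k * (x - c) - of_nat b) \<le> 1 / 2"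
      by (rule q2_residue)
    have "2 powi k * (x - c) - of_nat b = 2 powi k * (x - (c + of_nat b * 2 powi (- k)))"
      by (simp add: power_int_minus field_simps)
    then have "2 powi (- k) * norm2 (x - (c + of_nat b * 2 powi (- k))) \<le> 1 / 2"
      using b(2) by (simp only: norm2_mult norm2_two_powi)
    then have "norm2 (x - (c + of_nat b * 2 powi (- k))) \<le> 2 powi (k - 1)"
      by (simp add: power_int_minus power_int_diff field_simps)
    with b(1) show "x \<in> ?R" unfolding Un_iff mem_cball_q2 by auto
  next
    fix x assume "x \<in> ?R"
    then consider "norm2 (x - c) \<le> 2 powi (k - 1)" | "norm2 (x - (c + 2 powi (- k))) \<le> 2 powi (k - 1)"
      by (auto simp only: mem_cball_q2)
    then show "x \<in> ?L"
    proof cases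
      case 1
      then show ?thesis unfolding mem_cball_q2 using le by linarith
    next
      case 2
      have "norm2 (c + 2 powi (- k) - c) \<le> 2 powi k" by simp
      with 2 le show ?thesis unfolding mem_cball_q2
        by (meson norm2_diff_le_trans order_trans)
    qed
  qed
  show "cball c (2 powi (k - 1)) \<inter> cball (c + 2 powi (- k)) (2 powi (k - 1)) = {}"
  proof (rule ccontr)
    assume "\<not> ?thesis"
    then obtain x where "norm2 (c + 2 powi (- k) - x) \<le> 2 powi (k - 1)" "norm2 (x - c) \<le> 2 powi (k - 1)"
      unfolding ex_in_conv[symmetric] Int_iff mem_cball_q2 by (metis norm2_minus_commute)
    from norm2_diff_le_trans[OF this] show False by simp
  qed
qed

lemma cball_q2_finite_cover:
  "\<exists>F. finite F \<and> cball (c::q2) (2 powi k) \<subseteq> (\<Union>x\<in>F. cball x (2 powi (k - int n)))"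
proof (induction n arbitrary: k c)
  case 0
  show ?case by (rule exI[of _ "{c}"]) simp
next
  case (Suc n)
  obtain F G where "finite F" "cball c (2 powi (k - 1)) \<subseteq> (\<Union>x\<in>F. cball x (2 powi (k - 1 - int n)))"
     "finite G" "cball (c + 2 powi (- k)) (2 powi (k - 1)) \<subseteq> (\<Union>x\<in>G. cball x (2 powi (k - 1 - int n)))"
    using Suc.IH by meson
  moreover have "k - int (Suc n) = k - 1 - int n" by simp
  ultimately show ?case
    by (intro exI[of _ "F \<union> G"]) (auto simp only: cball_q2_halve(1)[of c k] finite_Un)
qed

lemma two_powi_small:
  assumes "e > 0"
  obtains k where "2 powi (- int k) < (e::real)"
proof -
  obtain k where "(1/2::real) ^ k < e" using real_arch_pow_inv[OF assms, of "1/2"] by auto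
  then show thesis using that[of k] by (simp add: power_int_minus power_one_over inverse_eq_divide)
qed

lemma two_powi_large:
  obtains k where "(e::real) \<le> 2 powi (int k)"
proof -
  obtain k where "e < (2::real) ^ k" using real_arch_pow[of 2 e] by auto
  then show thesis using that[of k] by simp
qed

lemma compact_cball_q2: "compact (cball (c::q2) r)"
  unfolding compact_eq_totally_bounded
proof (intro conjI allI impI)
  show "complete (cball c r)" by (simp add: complete_eq_closed)
  fix e :: real assume "e > 0"
  then obtain n where n: "2 powi (- int n) < e" by (rule two_powi_small)
  obtain k where k: "r \<le> 2 powi (int k)" by (rule two_powi_large)
  \<comment> \<open>\<open>k + n\<close> halvings bring the radius from \<open>2 powi k\<close> down
    to \<open>2 powi (- n)\<close>, which is below \<open>e\<close>.\<close>
  obtain F where F: "finite F"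
      "cball c (2 powi (int k)) \<subseteq> (\<Union>x\<in>F. cball x (2 powi (int k - int (k + n))))"
    using cball_q2_finite_cover[of c "int k" "k + n"] by auto
  have "cball x (2 powi (int k - int (k + n))) \<subseteq> ball x e" for x :: q2
  proof -
    have "int k - int (k + n) = - int n" by simp
    then show ?thesis using n by (simp add: subset_eq)
  qed
  then have "cball c r \<subseteq> (\<Union>x\<in>F. ball x e)"
    using F(2) subset_cball[OF k, of c] by blast
  with F(1) show "\<exists>F. finite F \<and> cball c r \<subseteq> (\<Union>x\<in>F. ball x e)" by blast
qed

instance q2 :: heine_borel
proof
  fix f :: "nat \<Rightarrow> q2" assume "bounded (range f)"
  then obtain c r where "range f \<subseteq> cball c r" unfolding bounded_subset_cball by blast
  then have "\<forall>n. f n \<in> cball c r" by blast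
  then show "\<exists>l r. strict_mono (r::nat\<Rightarrow>nat) \<and> ((f \<circ> r) \<longlongrightarrow> l) sequentially"
    using compact_cball_q2[of c r] unfolding compact_def by blast
qed

instance q2 :: second_countable_topology
proof
  let ?B = "(\<lambda>(r, n). ball (q2_of_rat r) (2 powi (- int n))) ` (UNIV :: (rat \<times> nat) set)"
  have "topological_basis ?B"
  proof (rule topological_basisI)
    show "open B" if "B \<in> ?B" for B using that by auto
    fix U :: "q2 set" and x assume "open U" "x \<in> U"
    then obtain e where e: "e > 0" "ball x e \<subseteq> U" using open_contains_ball by blast
    then obtain n where n: "2 powi (- int n) < e / 2" using two_powi_small half_gt_zero by metis
    obtain r where r: "norm2 (x - q2_of_rat r) < 2 powi (- int n)"
      by (rule q2_of_rat_dense[of "2 powi (- int n)" x]) auto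
    have "ball (q2_of_rat r) (2 powi (- int n)) \<subseteq> ball x e"
    proof
      fix y assume "y \<in> ball (q2_of_rat r) (2 powi (- int n))"
      then have "dist x y \<le> dist x (q2_of_rat r) + dist (q2_of_rat r) y" "dist (q2_of_rat r) y < 2 powi (- int n)"
        by (auto simp: dist_triangle)
      then show "y \<in> ball x e" using r n by (simp add: dist_q2_def)
    qed
    moreover have "x \<in> ball (q2_of_rat r) (2 powi (- int n))"
      using r by (simp add: dist_q2_def norm2_minus_commute)
    moreover have "ball (q2_of_rat r) (2 powi (- int n)) \<in> ?B"
      by (rule image_eqI[of _ _ "(r, n)"]) simp_all
    ultimately show "\<exists>B\<in>?B. x \<in> B \<and> B \<subseteq> U" using e(2) by (meson order_trans)
  qed
  then have "open = generate_topology ?B" by (rule topological_basis_imp_subbasis)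
  moreover have "countable ?B" by simp
  ultimately show "\<exists>B::q2 set set. countable B \<and> open = generate_topology B" by blast
qed

section \<open>The additive character\<close>

text \<open>Digits are extracted greedily: subtract the residue, divide by 2, repeat. The remainder
  stays in the unit ball, so the error after \<open>N\<close> digits is \<open>2 ^ N\<close> times a
  2-adic integer.\<close>

lemma q2_digit_expansion:
  assumes "norm2 z \<le> 1"
  obtains d :: "nat \<Rightarrow> nat" where "\<forall>k. d k \<in> {0, 1}"
    "\<And>N. norm2 (z - (\<Sum>k<N. of_nat (d k) * 2 ^ k)) \<le> (1 / 2) ^ N"
proof -
  have "\<forall>y. \<exists>b::nat. b \<in> {0, 1} \<and> (norm2 y \<le> 1 \<longrightarrow> norm2 (y - of_nat b) \<le> 1 / 2)"
    using q2_residue by blast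
  then obtain D :: "q2 \<Rightarrow> nat"
    where D: "\<And>y. D y \<in> {0, 1}" "\<And>y. norm2 y \<le> 1 \<Longrightarrow> norm2 (y - of_nat (D y)) \<le> 1 / 2"
    by metis
  define w where "w = rec_nat z (\<lambda>_ y. (y - of_nat (D y)) / 2)"
  have w: "w 0 = z" "w (Suc k) = (w k - of_nat (D (w k))) / 2" for k by (simp_all add: w_def)
  have n: "norm2 (w k) \<le> 1" for k
  proof (induction k)
    case (Suc k)
    then show ?case using D(2)[OF Suc] by (simp add: w norm2_divide norm2_two)
  qed (simp add: w assms)
  have "z - (\<Sum>k<N. of_nat (D (w k)) * 2 ^ k) = 2 ^ N * w N" for N
  proof (induction N)
    case (Suc N)
    have "z - (\<Sum>k<Suc N. of_nat (D (w k)) * 2 ^ k) = 2 ^ N * w N - of_nat (D (w N)) * 2 ^ N"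
      using Suc by (simp add: algebra_simps)
    also have "\<dots> = 2 ^ Suc N * w (Suc N)" by (simp add: w field_simps)
    finally show ?case .
  qed (simp add: w)
  then have "norm2 (z - (\<Sum>k<N. of_nat (D (w k)) * 2 ^ k)) \<le> (1 / 2) ^ N" for N
    using mult_left_mono[OF n[of N], of "(1 / 2) ^ N"] by (simp add: norm2_mult)
  with D(1) show thesis using that[of "\<lambda>k. D (w k)"] by simp
qed

lemma q2_sums_iff: "f sums s \<longleftrightarrow> (\<lambda>N. norm2 (s - (\<Sum>k<N. f k))) \<longlonglongrightarrow> 0" for f :: "nat \<Rightarrow> q2"
  unfolding sums_def
  by (subst tendsto_dist_iff) (simp add: dist_q2_def norm2_minus_commute[of s])

text \<open>The difference of the two fractions is a 2-adic integer with a power of two as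
  denominator, so the denominator divides the numerator. Hence \<open>exp\<close> of
  \<open>2 pi i\<close> times such an approximant does not depend on the choice.\<close>

lemma dyadic_congruent:
  assumes "norm2 (t - of_int p / 2 ^ m) \<le> 1" "norm2 (t - of_int q / 2 ^ n) \<le> 1"
  obtains i :: int where "real_of_int p / 2 ^ m = real_of_int q / 2 ^ n + of_int i"
proof -
  let ?u = "p * 2 ^ n - q * 2 ^ m"
  have "of_int p / 2 ^ m - of_int q / 2 ^ n = (of_int ?u / 2 ^ (m + n) :: q2)"
    by (simp add: field_simps power_add)
  moreover have "norm2 (of_int p / 2 ^ m - of_int q / 2 ^ n) \<le> 1"
    using norm2_diff_le_trans[OF _ assms(2)] assms(1) by (simp add: norm2_minus_commute)
  ultimately have "norm2 (of_int ?u / 2 ^ (m + n)) \<le> 1" by simp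
  then have "norm2 (of_int ?u) \<le> (1 / 2) ^ (m + n)"
    by (simp only: norm2_divide norm2_two_power) (simp add: field_simps)
  then obtain i where "?u = 2 ^ (m + n) * i" unfolding norm2_of_int_le by blast
  then have "real_of_int ?u = 2 ^ (m + n) * of_int i" by simp
  then have "real_of_int p / 2 ^ m = real_of_int q / 2 ^ n + of_int i"
    by (simp add: field_simps power_add)
  then show thesis by (rule that)
qed

text \<open>Discharges the definite description in \<open>frac2\<close> and keeps the one property
  needed afterwards: the fractional part is a dyadic rational congruent to \<open>t\<close> modulo
  the 2-adic integers.\<close>

lemma q2_dyadic_approx:
  obtains p :: int and m :: nat where "norm2 (t - of_int p / 2 ^ m) \<le> 1"
    and "frac2 t = of_int p / 2 ^ m"
proof -
  let ?P = "\<lambda>r. \<exists>m::nat. \<exists>d::nat \<Rightarrow> nat. (\<forall>k. d k \<in> {0, 1}) \<and>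
      (\<lambda>k. of_nat (d k) * 2 powi (int k - int m)) sums t \<and>
      r = (\<Sum>k<m. real (d k) * 2 powi (int k - int m))"
  have P: "\<exists>p::int. \<exists>m. r = of_int p / 2 ^ m \<and> 0 \<le> r \<and> r < 1 \<and> norm2 (t - of_int p / 2 ^ m) \<le> 1"
    if "?P r" for r
  proof -
    from that obtain m d where d: "\<forall>k. d k \<in> {0, 1::nat}"
      and s: "(\<lambda>k. of_nat (d k) * 2 powi (int k - int m)) sums t"
      and r: "r = (\<Sum>k<m. real (d k) * 2 powi (int k - int m))" by blast
    define p where "p = (\<Sum>k<m. int (d k) * 2 ^ k)"
    have pi: "x powi (int k - int m) = x ^ k / x ^ m" if "x \<noteq> 0" for x :: "'a::field" and k
      using that by (simp add: power_int_diff)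
    have 1: "r = of_int p / 2 ^ m"
      by (simp add: r p_def pi sum_divide_distrib)
    have le: "int (d k) \<le> 1" for k using d[rule_format, of k] by auto
    have "p \<le> (\<Sum>k<m. 2 ^ k)"
      unfolding p_def using le by (intro sum_mono) (simp add: mult_left_le_one_le)
    also have "\<dots> < 2 ^ m" by (induction m) simp_all
    finally have "p < 2 ^ m" .
    then have "real_of_int p < 2 ^ m" by (metis of_int_less_iff of_int_numeral of_int_power)
    then have 2: "r < 1" by (simp add: 1)
    have 3: "0 \<le> r" by (simp add: r sum_nonneg)
    obtain N where N: "\<And>n. n \<ge> N \<Longrightarrow>
        norm2 (t - (\<Sum>k<n. of_nat (d k) * 2 powi (int k - int m))) < 1"
      using order_tendstoD(2)[OF s[unfolded q2_sums_iff], of 1] by (auto simp: eventually_sequentially)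
    \<comment> \<open>Terms with index at least \<open>m\<close> are integers, so no partial sum
      beyond \<open>m\<close> leaves the coset of \<open>of_int p / 2 ^ m\<close>; a long one is
      also close to \<open>t\<close>.\<close>
    have "norm2 ((\<Sum>k<m + j. of_nat (d k) * 2 powi (int k - int m)) - of_int p / 2 ^ m) \<le> 1" for j
    proof (induction j)
      case 0
      show ?case by (simp add: p_def pi sum_divide_distrib)
    next
      case (Suc j)
      let ?s = "\<lambda>n. \<Sum>k<n. of_nat (d k) * 2 powi (int k - int m) :: q2"
      have "?s (m + Suc j) - ?s (m + j) = of_int (int (d (m + j)) * 2 ^ j)" by simp
      then have "norm2 (?s (m + Suc j) - ?s (m + j)) \<le> 1"
        using norm2_of_int_le_1 by metis
      then show ?case using Suc norm2_diff_le_trans by blast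
    qed
    from norm2_diff_le_trans[OF less_imp_le[OF N[of "m + N"]] this[of N]]
    have "norm2 (t - of_int p / 2 ^ m) \<le> 1" by simp
    with 1 2 3 show ?thesis by blast
  qed
  have ex: "\<exists>r. ?P r"
  proof -
    \<comment> \<open>Multiplying by \<open>2 ^ m\<close> moves \<open>t\<close> into the unit ball,
      where the digit expansion applies; dividing back shifts the exponents by
      \<open>m\<close>.\<close>
    obtain m where m: "norm2 t \<le> 2 powi (int m)" using two_powi_large by blast
    have "norm2 (2 ^ m * t) \<le> 1"
      using m by (simp add: norm2_mult power_one_over field_simps)
    then obtain d :: "nat \<Rightarrow> nat" where d: "\<forall>k. d k \<in> {0, 1}"
      and n: "\<And>N. norm2 (2 ^ m * t - (\<Sum>k<N. of_nat (d k) * 2 ^ k)) \<le> (1 / 2) ^ N"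
      by (rule q2_digit_expansion) blast
    have "(\<lambda>k. of_nat (d k) * 2 powi (int k - int m)) sums t"
      unfolding q2_sums_iff
    proof (rule Lim_null_comparison)
      show "\<forall>\<^sub>F N in sequentially. norm (norm2 (t - (\<Sum>k<N. of_nat (d k) * 2 powi (int k - int m))))
          \<le> 2 ^ m * (1 / 2) ^ N"
      proof (intro always_eventually allI)
        fix N
        have e: "2 ^ m * t - (\<Sum>k<N. of_nat (d k) * 2 ^ k) =
            2 ^ m * (t - (\<Sum>k<N. of_nat (d k) * 2 powi (int k - int m)))"
          by (simp add: right_diff_distrib sum_distrib_left power_int_diff)
        have "(1 / 2) ^ m * norm2 (t - (\<Sum>k<N. of_nat (d k) * 2 powi (int k - int m))) \<le> (1 / 2) ^ N"
          using n[of N] unfolding e norm2_mult norm2_two_power .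
        then show "norm (norm2 (t - (\<Sum>k<N. of_nat (d k) * 2 powi (int k - int m)))) \<le> 2 ^ m * (1 / 2) ^ N"
          by (simp add: norm2_nonneg power_one_over field_simps)
      qed
      show "(\<lambda>N. 2 ^ m * (1 / 2) ^ N :: real) \<longlonglongrightarrow> 0"
        by (intro tendsto_mult_right_zero LIMSEQ_power_zero) simp
    qed
    with d show ?thesis by blast
  qed
  \<comment> \<open>Two candidates differ by an integer, and both lie in the half-open interval from
    0 to 1.\<close>
  have uniq: "r = r'" if r: "?P r" and r': "?P r'" for r r'
  proof -
    obtain p :: int and m where p: "r = of_int p / 2 ^ m" "0 \<le> r" "r < 1" "norm2 (t - of_int p / 2 ^ m) \<le> 1"
      using P[OF r] by blast
    obtain q :: int and n where q: "r' = of_int q / 2 ^ n" "0 \<le> r'" "r' < 1" "norm2 (t - of_int q / 2 ^ n) \<le> 1"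
      using P[OF r'] by blast
    obtain i :: int where i: "r = r' + of_int i"
      using dyadic_congruent[OF p(4) q(4)] p(1) q(1) by metis
    then have "i < 1" "i > -1" using p q by linarith+
    then show ?thesis using i by simp
  qed
  have "\<exists>!r. ?P r" using ex uniq by (rule ex_ex1I)
  then have "?P (frac2 t)" unfolding frac2_def by (rule theI')
  from P[OF this] show thesis using that by blast
qed

text \<open>Frees \<open>chi2\<close> from \<open>frac2\<close>: any dyadic approximant gives the
  value. Additivity then follows by adding approximants over a common denominator, with no carry to
  track.\<close>

lemma chi2_eq:
  assumes "norm2 (t - of_int p / 2 ^ m) \<le> 1"
  shows "chi2 t = exp (2 * of_real pi * \<i> * of_real (of_int p / 2 ^ m))"
proof -
  obtain q :: int and n where q: "norm2 (t - of_int q / 2 ^ n) \<le> 1" "frac2 t = of_int q / 2 ^ n"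
    by (rule q2_dyadic_approx)
  obtain i :: int where "frac2 t = of_int p / 2 ^ m + of_int i"
    using dyadic_congruent[OF q(1) assms] q(2) by metis
  then show ?thesis
    unfolding chi2_def exp_eq by (intro exI[of _ i]) (simp add: algebra_simps)
qed

lemma chi2_add: "chi2 (s + t) = chi2 s * chi2 t"
proof -
  obtain p :: int and m where p: "norm2 (s - of_int p / 2 ^ m) \<le> 1" by (rule q2_dyadic_approx)
  obtain q :: int and n where q: "norm2 (t - of_int q / 2 ^ n) \<le> 1" by (rule q2_dyadic_approx)
  have "s + t - of_int (p * 2 ^ n + q * 2 ^ m) / 2 ^ (m + n)
      = (s - of_int p / 2 ^ m) + (t - of_int q / 2 ^ n)"
    by (simp add: field_simps power_add)
  moreover have "norm2 ((s - of_int p / 2 ^ m) + (t - of_int q / 2 ^ n)) \<le> 1"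
    by (rule order_trans[OF norm2_add_max]) (simp add: p q)
  ultimately have "norm2 (s + t - of_int (p * 2 ^ n + q * 2 ^ m) / 2 ^ (m + n)) \<le> 1"
    by (simp only:)
  from chi2_eq[OF this] show ?thesis
    unfolding chi2_eq[OF p] chi2_eq[OF q] exp_add[symmetric]
    by (simp add: field_simps power_add)
qed

lemma chi2_eq_1: "norm2 t \<le> 1 \<Longrightarrow> chi2 t = 1"
  using chi2_eq[of t 0 0] by simp

lemma chi2_0 [simp]: "chi2 0 = 1"
  by (simp add: chi2_eq_1)

lemma chi2_half: "chi2 (1 / 2) = - 1"
  using chi2_eq[of "1 / 2" 1 1] exp_pi_i' by (simp add: mult.commute)

lemma norm_chi2 [simp]: "norm (chi2 t) = 1"
  by (simp add: chi2_def mult.assoc)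

lemma chi2_cong:
  assumes "norm2 (s - t) \<le> 1"
  shows "chi2 s = chi2 t"
  using chi2_add[of "s - t" t] chi2_eq_1[OF assms] by simp

lemma chi2_sum: "chi2 (\<Sum>i\<in>A. f i) = (\<Prod>i\<in>A. chi2 (f i))"
  by (induction A rule: infinite_finite_induct) (simp_all add: chi2_add)

section \<open>Haar measure\<close>

text \<open>Bit reversal at the binary point: the integer \<open>\<Sum> b\<^sub>i 2\<^sup>i\<close> goes to \<open>\<Sum> b\<^sub>i 2\<^sup>-\<^sup>i\<^sup>-\<^sup>1\<close>.
  This enumerates the cosets of the 2-adic integers.\<close>

fun bit_reversal :: "nat \<Rightarrow> q2" where
  "bit_reversal q = (if q = 0 then 0 else (of_nat (q mod 2) + bit_reversal (q div 2)) / 2)"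

declare bit_reversal.simps [simp del]

lemma bit_reversal_double:
  assumes "b \<in> {0, 1}"
  shows "bit_reversal (2 * q + b) = (of_nat b + bit_reversal q) / 2"
proof (cases "2 * q + b = 0")
  case False
  then show ?thesis using assms bit_reversal.simps[of "2 * q + b"] by auto
qed (auto simp: bit_reversal.simps)

text \<open>Induction on the exponent bounding the norm: doubling \<open>t\<close> lowers it by one,
  and the residue left after the inductive approximation is the new lowest bit.\<close>

lemma bit_reversal_surj: "\<exists>q. norm2 (t - bit_reversal q) \<le> 1"
proof -
  have "norm2 t \<le> 2 ^ m \<Longrightarrow> \<exists>q. norm2 (t - bit_reversal q) \<le> 1" for m
  proof (induction m arbitrary: t)
    case 0
    then show ?case by (intro exI[of _ 0]) (simp add: bit_reversal.simps)
  next
    case (Suc m)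
    then have "norm2 (2 * t) \<le> 2 ^ m" by (simp add: norm2_mult norm2_two)
    then obtain q where "norm2 (2 * t - bit_reversal q) \<le> 1" using Suc.IH by blast
    then obtain b :: nat where b: "b \<in> {0, 1}" "norm2 (2 * t - bit_reversal q - of_nat b) \<le> 1 / 2"
      by (rule q2_residue)
    have "2 * t - bit_reversal q - of_nat b = 2 * (t - bit_reversal (2 * q + b))"
      unfolding bit_reversal_double[OF b(1)] by (simp add: field_simps)
    with b(2) have "norm2 (2 * (t - bit_reversal (2 * q + b))) \<le> 1 / 2" by (simp only:)
    then have "norm2 (t - bit_reversal (2 * q + b)) \<le> 1"
      by (simp only: norm2_mult norm2_two)
    then show ?case by blast
  qed
  moreover obtain m where "norm2 t \<le> 2 powi (int m)" by (rule two_powi_large)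
  ultimately show ?thesis by simp
qed

text \<open>One step of the injectivity proof. Doubling the difference gives \<open>u + d\<close> of
  norm at most \<open>1 / 2\<close>, with \<open>d\<close> the difference of the lowest bits. Since
  \<open>d\<close> is an integer, \<open>u\<close> is a 2-adic integer; if \<open>u\<close>
  vanishes, \<open>d\<close> is even and hence zero.\<close>

lemma bit_reversal_close:
  assumes "norm2 (bit_reversal q - bit_reversal q') \<le> 1"
  shows "norm2 (bit_reversal (q div 2) - bit_reversal (q' div 2)) \<le> 1"
    and "q div 2 = q' div 2 \<Longrightarrow> q mod 2 = q' mod 2"
proof -
  define d u where "d = int (q mod 2) - int (q' mod 2)"
    and "u = bit_reversal (q div 2) - bit_reversal (q' div 2)"
  have r: "bit_reversal p = (of_nat (p mod 2) + bit_reversal (p div 2)) / 2" for p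
    using bit_reversal_double[of "p mod 2" "p div 2"]
    by (metis mult_div_mod_eq not_mod_2_eq_1_eq_0 insertCI)
  have "of_int d = (of_nat (q mod 2) - of_nat (q' mod 2) :: q2)"
    by (simp only: d_def of_int_diff of_int_of_nat_eq)
  then have "bit_reversal q - bit_reversal q' = (u + of_int d) / 2"
    unfolding r[of q] r[of q'] u_def
    by (simp only: diff_divide_distrib[symmetric] add_diff_add add.commute)
  with assms have "norm2 ((u + of_int d) / 2) \<le> 1" by (simp only:)
  then have 1: "norm2 (u + of_int d) \<le> 1 / 2"
    unfolding norm2_half by linarith
  then show "norm2 (bit_reversal (q div 2) - bit_reversal (q' div 2)) \<le> 1"
    using norm2_diff_max[of "u + of_int d" "of_int d"] norm2_of_int_le_1[of d]
    by (simp add: u_def)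
  show "q mod 2 = q' mod 2" if "q div 2 = q' div 2"
  proof -
    from 1 that have "norm2 (of_int d) \<le> (1 / 2) ^ 1" by (simp add: u_def)
    then have "even d" unfolding norm2_of_int_le by simp
    then show ?thesis unfolding d_def by presburger
  qed
qed

lemma bit_reversal_inj:
  assumes "norm2 (bit_reversal q - bit_reversal q') \<le> 1"
  shows "q = q'"
  using assms
proof (induction "q + q'" arbitrary: q q' rule: less_induct)
  case less
  show ?case
  proof (cases "q + q' = 0")
    case False
    then have "q div 2 + q' div 2 < q + q'" by linarith
    then have "q div 2 = q' div 2"
      using less.hyps bit_reversal_close(1)[OF less.prems] by blast
    moreover from this have "q mod 2 = q' mod 2"
      by (rule bit_reversal_close(2)[OF less.prems])
    ultimately show ?thesis by (metis div_mult_mod_eq)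
  qed simp
qed

text \<open>A one-sided inverse of the Monna map: the real number \<open>\<Sum> b\<^sub>i 2\<^sup>-\<^sup>i\<close> goes to \<open>\<Sum> b\<^sub>i 2\<^sup>i\<^sup>-\<^sup>1\<close>,
  so that 2-adic balls correspond to dyadic intervals.\<close>

definition digit_approx :: "real \<Rightarrow> nat \<Rightarrow> q2" where
  "digit_approx x N = 2 ^ N * bit_reversal (nat \<lfloor>2 ^ N * x\<rfloor>)"

definition digit_map :: "real \<Rightarrow> q2" where
  "digit_map x = lim (digit_approx x)"

text \<open>Passing from \<open>N\<close> to \<open>Suc N\<close> appends one low bit
  \<open>b\<close> to the integer part, and by \<open>bit_reversal_double\<close> this adds exactly
  \<open>2 ^ N * b\<close>.\<close>

lemma digit_approx_Suc:
  assumes "x \<ge> 0"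
  shows "norm2 (digit_approx x (Suc N) - digit_approx x N) \<le> (1 / 2) ^ N"
proof -
  define q where "q = nat \<lfloor>2 ^ N * x\<rfloor>"
  obtain b :: nat where b: "b \<in> {0, 1}" "nat \<lfloor>2 ^ Suc N * x\<rfloor> = 2 * q + b"
  proof -
    define y where "y = 2 ^ N * x"
    have "y \<ge> 0" using assms by (simp add: y_def)
    have "\<lfloor>2 * y\<rfloor> = 2 * \<lfloor>y\<rfloor> \<or> \<lfloor>2 * y\<rfloor> = 2 * \<lfloor>y\<rfloor> + 1" by linarith
    moreover have "\<lfloor>y\<rfloor> \<ge> 0" using \<open>y \<ge> 0\<close> by simp
    ultimately have "nat \<lfloor>2 * y\<rfloor> = 2 * q + 0 \<or> nat \<lfloor>2 * y\<rfloor> = 2 * q + 1"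
      unfolding q_def y_def[symmetric] by (auto simp: nat_add_distrib nat_mult_distrib)
    then show thesis using that[of 0] that[of 1] by (auto simp: y_def mult.assoc)
  qed
  have "digit_approx x (Suc N) = 2 ^ N * (of_nat b + bit_reversal q)"
    unfolding digit_approx_def b(2) bit_reversal_double[OF b(1)] by simp
  then have "digit_approx x (Suc N) - digit_approx x N = 2 ^ N * of_int (int b)"
    by (simp add: digit_approx_def q_def algebra_simps)
  then show ?thesis
    using norm2_of_int_le_1[of "int b"] by (simp only: norm2_mult norm2_two_power) (simp add: mult_left_le)
qed

lemma digit_approx_le:
  assumes "x \<ge> 0" "N \<le> M"
  shows "norm2 (digit_approx x M - digit_approx x N) \<le> (1 / 2) ^ N"
  using assms(2)
proof (induction M rule: dec_induct)
  case (step M)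
  have "norm2 (digit_approx x (Suc M) - digit_approx x M) \<le> (1 / 2) ^ N"
    by (rule order_trans[OF digit_approx_Suc[OF assms(1)] power_decreasing]) (use step in auto)
  then show ?case using step.IH by (rule norm2_diff_le_trans)
qed simp

lemma digit_map_approx:
  assumes "x \<ge> 0"
  shows "norm2 (digit_map x - digit_approx x N) \<le> (1 / 2) ^ N"
proof -
  have "Cauchy (digit_approx x)"
  proof (rule metric_CauchyI)
    fix e :: real assume "e > 0"
    then obtain N where N: "(1 / 2 :: real) ^ N < e" using real_arch_pow_inv[of e "1/2"] by auto
    have "dist (digit_approx x m) (digit_approx x n) < e" if "m \<ge> N" "n \<ge> N" for m n
      using norm2_diff_le_trans[of "digit_approx x m" "digit_approx x N" "(1 / 2) ^ N" "digit_approx x n"]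
        digit_approx_le[OF assms that(1)] digit_approx_le[OF assms that(2)] N
      by (simp add: dist_q2_def norm2_minus_commute)
    then show "\<exists>M. \<forall>m\<ge>M. \<forall>n\<ge>M. dist (digit_approx x m) (digit_approx x n) < e" by blast
  qed
  then have lim: "digit_approx x \<longlonglongrightarrow> digit_map x"
    unfolding digit_map_def by (simp add: Cauchy_convergent_iff convergent_LIMSEQ_iff)
  have "digit_map x \<in> cball (digit_approx x N) ((1 / 2) ^ N)"
  proof (rule closed_sequentially[OF closed_cball])
    show "(\<lambda>n. digit_approx x (n + N)) \<longlonglongrightarrow> digit_map x" using lim by (rule LIMSEQ_ignore_initial_segment)
  qed (simp add: mem_cball_q2 digit_approx_le[OF assms] del: mem_cball)
  then show ?thesis by (simp only: mem_cball_q2)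
qed

text \<open>Dividing by \<open>2 ^ N\<close> makes the ball a coset of the 2-adic integers, which
  has a unique index \<open>q\<close>. A nonnegative \<open>x\<close> lands in the ball exactly when
  the integer part of \<open>2 ^ N * x\<close> is \<open>q\<close>, so mass and interval length
  agree.\<close>

lemma digit_map_vimage:
  obtains q :: nat where
    "digit_map -` cball c ((1 / 2) ^ N) \<inter> {0..} = {real q / 2 ^ N ..< (real q + 1) / 2 ^ N}"
proof -
  obtain q where q: "norm2 (c / 2 ^ N - bit_reversal q) \<le> 1" using bit_reversal_surj by blast
  have "digit_map x \<in> cball c ((1 / 2) ^ N) \<longleftrightarrow> x \<in> {real q / 2 ^ N ..< (real q + 1) / 2 ^ N}"
    if x: "x \<ge> 0" for x
  proof -
    let ?p = "nat \<lfloor>2 ^ N * x\<rfloor>"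
    have "digit_map x \<in> cball c ((1 / 2) ^ N) \<longleftrightarrow> norm2 (digit_approx x N - c) \<le> (1 / 2) ^ N"
      unfolding mem_cball_q2 using digit_map_approx[OF x, of N] norm2_diff_le_trans
      by (metis norm2_minus_commute)
    also have "digit_approx x N - c = 2 ^ N * (bit_reversal ?p - c / 2 ^ N)"
      by (simp add: digit_approx_def field_simps)
    also have "norm2 \<dots> \<le> (1 / 2) ^ N \<longleftrightarrow> norm2 (bit_reversal ?p - c / 2 ^ N) \<le> 1"
      unfolding norm2_mult norm2_two_power by simp
    also have "\<dots> \<longleftrightarrow> ?p = q"
      using q norm2_diff_le_trans[OF _ q, of "bit_reversal ?p"] bit_reversal_inj[of ?p q]
      by (auto simp: norm2_minus_commute)
    also have "\<dots> \<longleftrightarrow> \<lfloor>2 ^ N * x\<rfloor> = int q" using x by auto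
    also have "\<dots> \<longleftrightarrow> x \<in> {real q / 2 ^ N ..< (real q + 1) / 2 ^ N}"
      by (simp add: floor_eq_iff field_simps)
    finally show ?thesis .
  qed
  moreover have "x \<ge> 0" if "x \<in> {real q / 2 ^ N ..< (real q + 1) / 2 ^ N}" for x
    using that by (auto intro: order_trans[rotated])
  ultimately have "digit_map -` cball c ((1 / 2) ^ N) \<inter> {0..} = {real q / 2 ^ N ..< (real q + 1) / 2 ^ N}"
    by (intro set_eqI) (auto simp del: mem_cball)
  then show thesis by (rule that)
qed

text \<open>An intersection-stable generator of the Borel sets. Balls are nested or disjoint, and
  the empty set is inserted for the disjoint case.\<close>

definition small_balls :: "q2 set set" where
  "small_balls = insert {} {cball c ((1 / 2) ^ N) | c N. True}"

lemma Int_stable_small_balls: "Int_stable small_balls"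
proof (rule Int_stableI)
  fix A B assume AB: "A \<in> small_balls" "B \<in> small_balls"
  show "A \<inter> B \<in> small_balls"
  proof (cases "A \<inter> B = {}")
    case False
    then obtain x where x: "x \<in> A" "x \<in> B" by blast
    then obtain c M d N where "A = cball c ((1 / 2) ^ M)" "B = cball d ((1 / 2) ^ N)"
      using AB unfolding small_balls_def by blast
    then have "A = cball x ((1 / 2) ^ M)" "B = cball x ((1 / 2) ^ N)"
      using cball_q2_eq x by metis+
    moreover have "min ((1 / 2) ^ M) ((1 / 2 :: real) ^ N) = (1 / 2) ^ max M N"
      by (simp add: min_def max_def power_decreasing_iff)
    ultimately have "A \<inter> B = cball x ((1 / 2) ^ max M N)"
      by (simp flip: cball_min_Int)
    then show ?thesis unfolding small_balls_def by blast
  qed (simp add: small_balls_def)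
qed

lemma cball_cover_q2: "\<exists>q. x \<in> cball (2 ^ N * bit_reversal q) ((1 / 2) ^ N)"
proof -
  obtain q where q: "norm2 (x / 2 ^ N - bit_reversal q) \<le> 1" using bit_reversal_surj by blast
  have "x - 2 ^ N * bit_reversal q = 2 ^ N * (x / 2 ^ N - bit_reversal q)"
    by (simp add: field_simps)
  then have "norm2 (x - 2 ^ N * bit_reversal q) \<le> (1 / 2) ^ N"
    using q by (simp only: norm2_mult norm2_two_power) simp
  then show ?thesis unfolding mem_cball_q2 by blast
qed

text \<open>An open set is the union of the balls centred at some
  \<open>2 ^ N * bit_reversal q\<close> that it contains, and there are only countably many of
  these.\<close>

lemma sets_borel_q2: "sets (borel :: q2 measure) = sigma_sets UNIV small_balls"
proof
  have "sigma_sets UNIV small_balls \<subseteq> sets (sigma UNIV {S :: q2 set. open S})"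
    unfolding borel_def[symmetric]
    by (rule sets.sigma_sets_subset') (auto simp: small_balls_def)
  then show "sigma_sets UNIV small_balls \<subseteq> sets (borel :: q2 measure)"
    unfolding borel_def .
  have "U \<in> sigma_sets UNIV small_balls" if U: "open U" for U :: "q2 set"
  proof -
    let ?b = "\<lambda>(q, N). cball (2 ^ N * bit_reversal q) ((1 / 2) ^ N)"
    let ?F = "?b ` {p. ?b p \<subseteq> U}"
    have "U \<subseteq> \<Union>?F"
    proof
      fix x assume "x \<in> U"
      then obtain e where e: "e > 0" "ball x e \<subseteq> U" using U open_contains_ball by blast
      then obtain N where N: "(1 / 2) ^ N < e" using real_arch_pow_inv[of e "1/2"] by auto
      obtain q where q: "x \<in> cball (2 ^ N * bit_reversal q) ((1 / 2) ^ N)"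
        using cball_cover_q2 by blast
      have "cball x ((1 / 2) ^ N) \<subseteq> ball x e" using N by (simp add: subset_eq)
      then have "?b (q, N) \<subseteq> U" using cball_q2_eq[OF q] e(2) by simp
      then show "x \<in> \<Union>?F" using q by (intro UnionI[of "?b (q, N)"] imageI) simp_all
    qed
    moreover have "\<Union>?F \<subseteq> U" by blast
    ultimately have "U = \<Union>?F" by (rule equalityI)
    moreover have "\<Union>?F \<in> sigma_sets UNIV small_balls"
      by (rule sigma_sets_UNION) (auto simp: small_balls_def intro!: sigma_sets.Basic)
    ultimately show ?thesis by simp
  qed
  then show "sets (borel :: q2 measure) \<subseteq> sigma_sets UNIV small_balls"
    unfolding borel_def by (subst sets_measure_of) (auto intro!: sigma_sets_mono)
qed

text \<open>The uniqueness principle behind Haar measure. The countably many cosets of the 2-adic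
  integers cover the space with finite mass, as agreement on a generator requires.\<close>

lemma measure_eqI_small_balls:
  fixes M N :: "q2 measure"
  assumes "sets M = sets borel" "sets N = sets borel"
    and M: "\<And>c k. emeasure M (cball c ((1 / 2) ^ k)) = ennreal ((1 / 2) ^ k)"
    and N: "\<And>c k. emeasure N (cball c ((1 / 2) ^ k)) = ennreal ((1 / 2) ^ k)"
  shows "M = N"
proof (rule measure_eqI_generator_eq)
  show "Int_stable small_balls" by (rule Int_stable_small_balls)
  show "emeasure M X = emeasure N X" if "X \<in> small_balls" for X
    using that M N by (auto simp: small_balls_def)
  show "sets M = sigma_sets UNIV small_balls" "sets N = sigma_sets UNIV small_balls"
    using assms(1,2) by (simp_all add: sets_borel_q2)
  let ?A = "\<lambda>q. cball (bit_reversal q) 1"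
  show "range ?A \<subseteq> small_balls"
    unfolding small_balls_def by (auto intro!: exI[of _ "0::nat"])
  show "(\<Union>q. ?A q) = UNIV" using cball_cover_q2[of _ 0] by auto
  show "emeasure M (?A q) \<noteq> \<infinity>" for q using M[of "bit_reversal q" 0] by simp
qed simp

definition haar_image :: "q2 measure" where
  "haar_image = distr (restrict_space lborel {0..}) borel digit_map"

lemma sets_haar_image: "sets haar_image = sets borel"
  by (simp add: haar_image_def)

lemma emeasure_haar_image: "emeasure haar_image (cball c ((1 / 2) ^ k)) = ennreal ((1 / 2) ^ k)"
proof -
  have vim: "digit_map -` A \<inter> {0..} \<in> sets borel" if "A \<in> small_balls" for A
  proof -
    from that consider "A = {}" | d N where "A = cball d ((1 / 2) ^ N)"
      unfolding small_balls_def by auto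
    then show ?thesis
    proof cases
      case 2
      obtain q where "digit_map -` A \<inter> {0..} = {real q / 2 ^ N ..< (real q + 1) / 2 ^ N}"
        unfolding 2 by (rule digit_map_vimage)
      then show ?thesis by simp
    qed simp
  qed
  \<comment> \<open>Measurability is tested on the generator only, where preimages are
    intervals.\<close>
  have m: "digit_map \<in> measurable (restrict_space lborel {0..}) borel"
  proof (rule measurable_sigma_sets[OF sets_borel_q2])
    show "digit_map -` A \<inter> space (restrict_space lborel {0..}) \<in> sets (restrict_space lborel {0..})"
      if "A \<in> small_balls" for A
      using vim[OF that] by (auto simp: sets_restrict_space space_restrict_space)
  qed auto
  have "emeasure haar_image (cball c ((1 / 2) ^ k)) =
      emeasure lborel (digit_map -` cball c ((1 / 2) ^ k) \<inter> {0..})"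
    unfolding haar_image_def
    by (subst emeasure_distr[OF m]) (auto simp: space_restrict_space emeasure_restrict_space)
  also obtain q where "digit_map -` cball c ((1 / 2) ^ k) \<inter> {0..} = {real q / 2 ^ k ..< (real q + 1) / 2 ^ k}"
    by (rule digit_map_vimage)
  also have "emeasure lborel \<dots> = ennreal ((1 / 2) ^ k)"
    by (simp add: field_simps)
  finally show ?thesis .
qed

section \<open>Translation invariance; existence and uniqueness of Haar measure\<close>

lemma continuous_on_q2_add: "continuous_on UNIV (\<lambda>x. x + c :: q2)"
  unfolding continuous_on_iff by (auto simp: dist_q2_def)

lemma image_add_q2: "(+) c ` A = (\<lambda>x. x + - c) -` A" for c :: q2
  by (auto simp: image_iff intro!: bexI[of _ "_ + - c"])

lemma image_add_cball_q2: "(+) c ` cball d r = cball (c + d) r" for c :: q2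
  unfolding image_add_q2 set_eq_iff vimage_eq mem_cball_q2 by (simp add: algebra_simps)

lemma translate_measurable_q2 [measurable]: "(\<lambda>x. x + c) \<in> borel_measurable borel" for c :: q2
  by (intro borel_measurable_continuous_onI continuous_on_q2_add)

text \<open>The predicate under the definite description in \<open>haar2\<close>, named so that a
  witness and uniqueness can be supplied separately.\<close>

definition is_haar2 :: "q2 measure \<Rightarrow> bool" where
  "is_haar2 M \<longleftrightarrow> sets M = sets borel \<and>
      (\<forall>c. \<forall>A\<in>sets borel. emeasure M ((+) c ` A) = emeasure M A) \<and>
      emeasure M {x. norm2 x \<le> 1} = 1"

text \<open>Invariance gives both halves of a ball equal mass, so mass doubles with the radius;
  induction in both directions starts from the normalised unit ball.\<close>

lemma is_haar2_cball:
  assumes "is_haar2 M"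
  shows "emeasure M (cball c (2 powi k)) = ennreal (2 powi k)"
proof -
  have sets: "cball d r \<in> sets M" for d r
    using assms by (simp add: is_haar2_def)
  have tr: "emeasure M (cball c r) = emeasure M (cball 0 r)" for c r
    using assms unfolding is_haar2_def by (metis image_add_cball_q2 add_0_right borel_closed closed_cball)
  let ?m = "\<lambda>k. emeasure M (cball 0 (2 powi k))"
  have half: "?m k = 2 * ?m (k - 1)" for k
    unfolding cball_q2_halve(1)[of 0 k]
    using plus_emeasure[OF sets sets cball_q2_halve(2)[of 0 k]] tr[of "0 + 2 powi (- k)"]
    by (simp add: mult_2)
  have "?m k = ennreal (2 powi k)"
  proof (induction k rule: int_induct[of _ 0])
    case base
    have "cball 0 1 = {x::q2. norm2 x \<le> 1}" by (auto simp: dist_q2_def norm2_minus)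
    then show ?case using assms by (simp add: is_haar2_def)
  next
    case (step1 i)
    have "ennreal (2 powi (i + 1)) = 2 * ennreal (2 powi i)"
      by (simp add: power_int_add ennreal_mult mult.commute)
    then show ?case using half[of "i + 1"] step1 by simp
  next
    case (step2 i)
    have "2 * ?m (i - 1) = 2 * ennreal (2 powi (i - 1))"
      using half[of i] step2 by (simp add: power_int_diff ennreal_mult[symmetric] flip: ennreal_numeral)
    then show ?case by (simp add: ennreal_mult_cancel_left)
  qed
  then show ?thesis by (simp add: tr[of c])
qed

lemma half_power_eq: "(1 / 2 :: real) ^ k = 2 powi (- int k)"
  by (simp add: power_int_minus power_one_over inverse_eq_divide)

lemma is_haar2_haar_image: "is_haar2 haar_image"
  unfolding is_haar2_def
proof (intro conjI allI ballI)
  show "sets haar_image = sets borel" by (rule sets_haar_image)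
  have "{x. norm2 x \<le> 1} = cball (0::q2) ((1 / 2) ^ 0)"
    by (auto simp: dist_q2_def norm2_minus)
  then show "emeasure haar_image {x. norm2 x \<le> 1} = 1"
    by (simp only: emeasure_haar_image) simp
  fix c :: q2 and A :: "q2 set" assume A: "A \<in> sets borel"
  \<comment> \<open>The translated measure agrees with \<open>haar_image\<close> on small balls,
    because translation keeps the radius; by \<open>measure_eqI_small_balls\<close> the two
    coincide.\<close>
  let ?D = "distr haar_image borel (\<lambda>x. x + - c)"
  have m: "(\<lambda>x. x + - c) \<in> measurable haar_image borel"
    using translate_measurable_q2 measurable_cong_sets[OF sets_haar_image refl] by blast
  have D: "emeasure ?D B = emeasure haar_image ((+) c ` B)" if "B \<in> sets borel" for B
    unfolding image_add_q2 using emeasure_distr[OF m that] sets_eq_imp_space_eq[OF sets_haar_image] by simp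
  have "?D = haar_image"
    by (rule measure_eqI_small_balls)
       (simp_all add: D[simplified] image_add_cball_q2 emeasure_haar_image sets_haar_image)
  then show "emeasure haar_image ((+) c ` A) = emeasure haar_image A"
    using D[OF A] by simp
qed

lemma is_haar2_unique: "is_haar2 M \<Longrightarrow> is_haar2 N \<Longrightarrow> M = N"
  by (rule measure_eqI_small_balls) (simp_all only: half_power_eq is_haar2_cball, simp_all add: is_haar2_def)

lemma is_haar2_haar2: "is_haar2 haar2"
proof -
  have "haar2 = (THE M. is_haar2 M)" by (simp add: haar2_def is_haar2_def)
  then show ?thesis
    using theI[of is_haar2, OF is_haar2_haar_image] is_haar2_unique[OF _ is_haar2_haar_image] by simp
qed

section \<open>Working properties of \<open>haar2\<close>\<close>

lemma sets_haar2 [simp, measurable_cong]: "sets haar2 = sets borel"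
  using is_haar2_haar2 by (simp add: is_haar2_def)

lemma space_haar2 [simp]: "space haar2 = UNIV"
  using sets_eq_imp_space_eq[OF sets_haar2] by simp

lemma emeasure_haar2_cball: "emeasure haar2 (cball c (2 powi k)) = ennreal (2 powi k)"
  using is_haar2_cball[OF is_haar2_haar2] .

lemma haar2_translate: "distr haar2 borel (\<lambda>x. x + c) = haar2"
proof (rule measure_eqI)
  fix A assume "A \<in> sets (distr haar2 borel (\<lambda>x. x + c))"
  then have A: "A \<in> sets borel" by simp
  have "emeasure (distr haar2 borel (\<lambda>x. x + c)) A = emeasure haar2 ((+) (- c) ` A)"
    unfolding image_add_q2 using A by (subst emeasure_distr) simp_all
  also have "\<dots> = emeasure haar2 A"
    using is_haar2_haar2 A unfolding is_haar2_def by blast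
  finally show "emeasure (distr haar2 borel (\<lambda>x. x + c)) A = emeasure haar2 A" .
qed simp

lemma sigma_finite_haar2: "sigma_finite_measure haar2"
proof
  let ?A = "range (\<lambda>k. cball (0::q2) (2 powi (int k)))"
  have "x \<in> \<Union>?A" for x
  proof -
    obtain k where "norm2 (x - 0) \<le> 2 powi (int k)" by (rule two_powi_large)
    then have "x \<in> cball 0 (2 powi (int k))" by (simp only: mem_cball_q2)
    then show ?thesis by blast
  qed
  then have "\<Union>?A = UNIV" by blast
  moreover have "emeasure haar2 a \<noteq> \<infinity>" if "a \<in> ?A" for a
  proof -
    from that obtain k where "a = cball 0 (2 powi (int k))" by blast
    then have "emeasure haar2 a = ennreal (2 powi (int k))" by (simp only: emeasure_haar2_cball)
    then show ?thesis by simp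
  qed
  ultimately show "\<exists>A. countable A \<and> A \<subseteq> sets haar2 \<and> \<Union>A = space haar2 \<and> (\<forall>a\<in>A. emeasure haar2 a \<noteq> \<infinity>)"
    by (intro exI[of _ ?A]) auto
qed

section \<open>One-dimensional integrals\<close>

lemma continuous_on_locally_constant_q2:
  fixes f :: "q2 \<Rightarrow> 'a::topological_space"
  assumes "r > 0" "\<And>x y. norm2 (y - x) \<le> r \<Longrightarrow> f y = f x"
  shows "continuous_on UNIV f"
  unfolding continuous_on_def
proof
  fix x :: q2
  have "open (cball x r)" using assms(1) by (rule open_cball_q2)
  moreover have "x \<in> cball x r" using assms(1) by simp
  moreover have "f y = f x" if "y \<in> cball x r" for y
    using that assms(2) unfolding mem_cball_q2 by blast
  ultimately have "\<forall>\<^sub>F y in at x. f y = f x"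
    unfolding eventually_at_topological by blast
  then show "(f \<longlongrightarrow> f x) (at x)" by (rule tendsto_eventually)
qed

text \<open>Uniform local constancy, the source of measurability here. The added 1 in the
  denominator keeps the radius meaningful for \<open>c = 0\<close>.\<close>

lemma chi2_mult_cong:
  assumes "norm2 (y - x) \<le> 1 / (norm2 c + 1)"
  shows "chi2 (c * y) = chi2 (c * x)"
proof (rule chi2_cong)
  have "norm2 (c * y - c * x) = norm2 c * norm2 (y - x)"
    by (simp flip: right_diff_distrib norm2_mult)
  also have "\<dots> \<le> norm2 c * (1 / (norm2 c + 1))"
    using assms by (rule mult_left_mono) (rule norm2_nonneg)
  also have "\<dots> \<le> 1" using norm2_nonneg[of c] by (simp add: field_simps)
  finally show "norm2 (c * y - c * x) \<le> 1" .
qed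

lemma chi2_mult_measurable [measurable]: "(\<lambda>x. chi2 (c * x)) \<in> borel_measurable borel"
  using norm2_nonneg[of c]
  by (intro borel_measurable_continuous_onI
      continuous_on_locally_constant_q2[of "1 / (norm2 c + 1)"] chi2_mult_cong) auto

text \<open>Orthogonality of characters on a ball: either the character is constant there, or some
  translation preserves the ball and flips the sign of the integrand.\<close>

lemma integral_chi2_cball:
  "(LINT x|haar2. indicat_real (cball b (2 powi j)) x *\<^sub>R chi2 (c * x)) =
    (if norm2 c * 2 powi j \<le> 1 then 2 powi j * chi2 (c * b) else 0)"
proof (cases "norm2 c * 2 powi j \<le> 1")
  case True
  have const: "chi2 (c * x) = chi2 (c * b)" if "x \<in> cball b (2 powi j)" for x
  proof (rule chi2_cong)
    have "norm2 (c * x - c * b) = norm2 c * norm2 (x - b)"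
      by (simp flip: right_diff_distrib norm2_mult)
    also have "\<dots> \<le> norm2 c * 2 powi j"
      using that unfolding mem_cball_q2 by (rule mult_left_mono) (rule norm2_nonneg)
    finally show "norm2 (c * x - c * b) \<le> 1" using True by simp
  qed
  have "indicat_real (cball b (2 powi j)) x *\<^sub>R chi2 (c * x) =
      indicat_real (cball b (2 powi j)) x *\<^sub>R chi2 (c * b)" for x
    using const[of x] by (cases "x \<in> cball b (2 powi j)") (simp_all del: mem_cball)
  then have "(LINT x|haar2. indicat_real (cball b (2 powi j)) x *\<^sub>R chi2 (c * x)) =
      (LINT x|haar2. indicat_real (cball b (2 powi j)) x *\<^sub>R chi2 (c * b))"
    by (simp only:)
  also have "\<dots> = measure haar2 (cball b (2 powi j)) *\<^sub>R chi2 (c * b)"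
    by (subst integral_scaleR_left) (auto simp: emeasure_haar2_cball)
  also have "measure haar2 (cball b (2 powi j)) = 2 powi j"
    by (simp add: measure_def emeasure_haar2_cball)
  finally show ?thesis using True by (simp add: scaleR_conv_of_real of_real_power_int)
next
  case False
  \<comment> \<open>Chosen so that \<open>c * y = 1 / 2\<close>, where the character takes the value
    \<open>- 1\<close>.\<close>
  define y where "y = 1 / (2 * c)"
  have "c \<noteq> 0" using False by auto
  then obtain i where i: "norm2 c = 2 powi i" by (rule norm2_value)
  have "norm2 y = 2 powi (1 - i)"
    by (simp add: y_def norm2_divide norm2_mult norm2_two i power_int_diff)
  \<comment> \<open>Norms are powers of two, so exceeding 1 means an exponent of at least 1; this is
    just enough for \<open>y\<close> to preserve the ball.\<close>
  moreover have "\<not> i + j \<le> 0"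
    using False two_powi_le_iff[of "i + j" 0] by (simp add: i power_int_add)
  ultimately have y: "norm2 y \<le> 2 powi j" by simp
  let ?f = "\<lambda>x. indicat_real (cball b (2 powi j)) x *\<^sub>R chi2 (c * x)"
  have "x + y \<in> cball b (2 powi j) \<longleftrightarrow> x \<in> cball b (2 powi j)" for x
  proof -
    have "norm2 (x + y - x) \<le> 2 powi j" "norm2 (x - (x + y)) \<le> 2 powi j"
      using y by (simp_all add: norm2_minus)
    then show ?thesis unfolding mem_cball_q2 using norm2_diff_le_trans by blast
  qed
  then have "indicat_real (cball b (2 powi j)) (x + y) = indicat_real (cball b (2 powi j)) x" for x
    by (simp only: indicator_def)
  moreover have "chi2 (c * (x + y)) = - chi2 (c * x)" for x
    using chi2_add[of "c * x" "1 / 2"] \<open>c \<noteq> 0\<close> by (simp add: chi2_half y_def distrib_left)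
  ultimately have shift: "?f (x + y) = - ?f x" for x
    by (simp del: mem_cball)
  have "integral\<^sup>L haar2 ?f = integral\<^sup>L (distr haar2 borel (\<lambda>x. x + y)) ?f"
    by (simp only: haar2_translate)
  also have "\<dots> = (LINT x|haar2. ?f (x + y))"
  proof (rule integral_distr)
    show "(\<lambda>x. x + y) \<in> measurable haar2 borel" by measurable
    have [measurable]: "cball b (2 powi j) \<in> sets borel" by simp
    show "?f \<in> borel_measurable borel" by measurable
  qed
  also have "\<dots> = - integral\<^sup>L haar2 ?f"
    unfolding shift by simp
  finally have "integral\<^sup>L haar2 ?f = 0" by simp
  then show ?thesis using False by simp
qed

definition wave :: "q2 \<Rightarrow> int \<Rightarrow> q2 \<Rightarrow> q2 \<Rightarrow> complex" where
  "wave h j a x = chi2 (h * (2 powi j * x - a)) * (if norm2 (2 powi j * x - a) \<le> 1 then 1 else 0)"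

lemma norm2_affine: "norm2 (2 powi j * x - a) = 2 powi (- j) * norm2 (x - 2 powi (- j) * a)"
proof -
  have "2 powi j * x - a = 2 powi j * (x - 2 powi (- j) * a)"
    by (simp add: right_diff_distrib power_int_minus mult.assoc[symmetric])
  then show ?thesis by (simp only: norm2_mult norm2_two_powi)
qed

text \<open>Collects the \<open>x\<close>-dependence into one character of frequency
  \<open>\<xi> + h * 2 powi j\<close> on a ball, which reduces wave integrals to
  \<open>integral_chi2_cball\<close>.\<close>

lemma chi2_wave_eq:
  "chi2 (\<xi> * x) * wave h j a x =
    indicat_real (cball (2 powi (- j) * a) (2 powi j)) x *\<^sub>R chi2 ((\<xi> + h * 2 powi j) * x) * chi2 (- (h * a))"
proof -
  have "norm2 (2 powi j * x - a) \<le> 1 \<longleftrightarrow> x \<in> cball (2 powi (- j) * a) (2 powi j)"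
    unfolding mem_cball_q2 norm2_affine by (simp add: power_int_minus field_simps)
  then show ?thesis
    by (simp add: wave_def indicator_def algebra_simps del: mem_cball flip: chi2_add)
qed

lemma wave_locally_constant:
  obtains r where "r > 0" "\<And>x y. norm2 (y - x) \<le> r \<Longrightarrow> wave h j a y = wave h j a x"
proof
  \<comment> \<open>The first bound preserves membership in the supporting ball, the second the
    value of the character of frequency \<open>h * 2 powi j\<close>.\<close>
  let ?r = "min (2 powi j) (1 / (norm2 (h * 2 powi j) + 1))"
  show "?r > 0" using norm2_nonneg[of "h * 2 powi j"] by auto
  fix x y assume r: "norm2 (y - x) \<le> ?r"
  have "chi2 (0 * x + h * 2 powi j * y) = chi2 (0 * x + h * 2 powi j * x)"
    using chi2_mult_cong[of y x "h * 2 powi j"] r by simp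
  moreover have "y \<in> cball b (2 powi j) \<longleftrightarrow> x \<in> cball b (2 powi j)" for b
  proof -
    have "norm2 (y - x) \<le> 2 powi j" "norm2 (x - y) \<le> 2 powi j"
      using r by (simp_all add: norm2_minus_commute)
    then show ?thesis unfolding mem_cball_q2 using norm2_diff_le_trans by blast
  qed
  ultimately show "wave h j a y = wave h j a x"
    using chi2_wave_eq[of 0 x h j a] chi2_wave_eq[of 0 y h j a]
    by (simp add: indicator_def del: mem_cball)
qed

lemma wave_measurable [measurable]: "wave h j a \<in> borel_measurable borel"
proof -
  obtain r where "r > 0" "\<And>x y. norm2 (y - x) \<le> r \<Longrightarrow> wave h j a y = wave h j a x"
    by (rule wave_locally_constant[of h j a]) blast
  then show ?thesis
    by (intro borel_measurable_continuous_onI continuous_on_locally_constant_q2)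
qed

lemma integrable_chi2_wave: "integrable haar2 (\<lambda>x. chi2 (\<xi> * x) * wave h j a x)"
proof (rule Bochner_Integration.integrable_bound)
  let ?B = "cball (2 powi (- j) * a) (2 powi j)"
  show "integrable haar2 (indicat_real ?B)"
    by (rule integrable_real_indicator) (simp_all add: emeasure_haar2_cball)
  show "AE x in haar2. norm (chi2 (\<xi> * x) * wave h j a x) \<le> norm (indicat_real ?B x)"
    unfolding chi2_wave_eq by (simp add: norm_mult)
qed measurable

text \<open>As a function of \<open>\<xi>\<close> the right-hand side is a constant times
  \<open>wave a (- j) (- h)\<close>: the roles of \<open>h\<close> and \<open>a\<close> are
  exchanged. The same lemma therefore also computes the inverse transform.\<close>

lemma integral_chi2_wave:
  "(LINT x|haar2. chi2 (\<xi> * x) * wave h j a x) =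
    2 powi j * chi2 (2 powi (- j) * \<xi> * a) * (if norm2 (2 powi (- j) * \<xi> + h) \<le> 1 then 1 else 0)"
proof -
  let ?c = "\<xi> + h * 2 powi j"
  have inv: "2 powi j * 2 powi (- j) = (1 :: q2)" by (simp add: power_int_minus)
  have "2 powi (- j) * \<xi> + h = 2 powi (- j) * ?c"
    using inv by (simp add: algebra_simps)
  then have "norm2 (2 powi (- j) * \<xi> + h) = norm2 ?c * 2 powi j"
    by (simp only: norm2_mult norm2_two_powi) simp
  moreover have "chi2 (?c * (2 powi (- j) * a)) * chi2 (- (h * a)) = chi2 (2 powi (- j) * \<xi> * a)"
  proof -
    have "?c * (2 powi (- j) * a) + - (h * a) = 2 powi (- j) * \<xi> * a + (2 powi j * 2 powi (- j) - 1) * h * a"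
      by (simp add: algebra_simps)
    then show ?thesis unfolding inv by (simp flip: chi2_add)
  qed
  ultimately show ?thesis
    unfolding chi2_wave_eq integral_mult_left_zero integral_chi2_cball by (simp add: mult.assoc)
qed

section \<open>Integration over vectors\<close>

text \<open>Second countability of \<open>q2\<close> identifies the product sigma-algebra with the
  Borel one, so continuity of \<open>vec_lambda\<close> suffices.\<close>

lemma vec_lambda_measurable: "vec_lambda \<in> measurable (\<Pi>\<^sub>M i\<in>UNIV. haar2) (borel :: (q2 ^ 'n::finite) measure)"
proof -
  have "sets (\<Pi>\<^sub>M i\<in>(UNIV :: 'n set). haar2) = sets (\<Pi>\<^sub>M i\<in>UNIV. borel)"
    by (rule sets_PiM_cong) simp_all
  also have "\<dots> = sets borel" by (rule sets_PiM_equal_borel)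
  finally have "sets (\<Pi>\<^sub>M i\<in>(UNIV :: 'n set). haar2) = sets borel" .
  moreover have "vec_lambda \<in> measurable borel (borel :: (q2 ^ 'n) measure)"
    by (intro borel_measurable_continuous_onI continuous_on_vec_lambda) (simp add: continuous_on_product_coordinates)
  ultimately show ?thesis using measurable_cong_sets by blast
qed

lemma integral_haar2_vec_prod:
  fixes g :: "'n::finite \<Rightarrow> q2 \<Rightarrow> complex"
  assumes "\<And>i. integrable haar2 (g i)"
  shows "(LINT x|haar2_vec. (\<Prod>i\<in>UNIV. g i (x $ i))) = (\<Prod>i\<in>UNIV. integral\<^sup>L haar2 (g i))"
proof -
  interpret product_sigma_finite "\<lambda>_ :: 'n. haar2"
    by (simp add: product_sigma_finite_def sigma_finite_haar2)
  have [measurable]: "g i \<in> borel_measurable borel" for i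
    using borel_measurable_integrable[OF assms[of i]] by simp
  have [measurable]: "(\<lambda>x :: q2 ^ 'n. x $ i) \<in> borel_measurable borel" for i
    by (intro borel_measurable_continuous_onI continuous_intros)
  have "(LINT x|haar2_vec. (\<Prod>i\<in>UNIV. g i (x $ i))) =
      (LINT x|(\<Pi>\<^sub>M i\<in>UNIV. haar2). (\<Prod>i\<in>UNIV. g i (x i)))"
    unfolding haar2_vec_def by (subst integral_distr[OF vec_lambda_measurable]) simp_all
  also have "\<dots> = (\<Prod>i\<in>UNIV. integral\<^sup>L haar2 (g i))"
    by (rule product_integral_prod) (simp_all add: assms)
  finally show ?thesis .
qed

section \<open>Wavelets as products\<close>

abbreviation half_ind :: "'n set \<Rightarrow> 'n \<Rightarrow> q2" where
  "half_ind e i \<equiv> (if i \<in> e then 1 / 2 else 0)"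

lemma norm2_vec_le: "norm2_vec x \<le> r \<longleftrightarrow> (\<forall>i. norm2 (x $ i) \<le> r)"
  unfolding norm2_vec_def by (subst Max_le_iff) auto

lemma norm2_vec_nonneg: "0 \<le> norm2_vec x"
  unfolding norm2_vec_def by (subst Max_ge_iff) (auto simp: norm2_nonneg)

lemma prod_if_zero_one:
  "(\<Prod>i\<in>(UNIV :: 'n::finite set). if P i then 1 else (0::complex)) = (if \<forall>i. P i then 1 else 0)"
  by (auto intro: prod_zero)

text \<open>The maximum norm makes the cutoff a product of coordinate cutoffs, and the character
  turns the scalar product into a product.\<close>

lemma Psi0_eq_prod:
  "Psi0 e j a x = of_real (2 powr (- real CARD('n) * of_int j / 2)) *
    (\<Prod>i\<in>UNIV. wave (half_ind e i) j (a $ i) (x $ i))"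
  for a :: "q2 ^ 'n::finite"
proof -
  have "inverse 2 * dot2 (k_vec e) (2 powi j *s x - a) =
      (\<Sum>i\<in>UNIV. half_ind e i * (2 powi j * x $ i - a $ i))"
    unfolding dot2_def k_vec_def sum_distrib_left
    by (intro sum.cong refl) (simp add: inverse_eq_divide)
  moreover have "of_real (Omega (norm2_vec (2 powi j *s x - a))) =
      (\<Prod>i\<in>UNIV. if norm2 (2 powi j * x $ i - a $ i) \<le> 1 then 1 else (0::complex))"
    by (simp add: prod_if_zero_one Omega_def norm2_vec_nonneg norm2_vec_le)
  ultimately show ?thesis
    by (simp add: Psi0_def wave_def chi2_sum prod.distrib)
qed

section \<open>Fourier transform of the wavelet, its support, and inversion\<close>

lemma fourier2_Psi0:
  "fourier2 (Psi0 e j a) \<xi> = of_real (2 powr (- real CARD('n) * of_int j / 2)) *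
    (\<Prod>i\<in>UNIV. 2 powi j * chi2 (2 powi (- j) * \<xi> $ i * a $ i) *
      (if norm2 (2 powi (- j) * \<xi> $ i + half_ind e i) \<le> 1 then 1 else 0))"
  for a :: "q2 ^ 'n::finite"
proof -
  have "chi2 (dot2 \<xi> x) * Psi0 e j a x = of_real (2 powr (- real CARD('n) * of_int j / 2)) *
      (\<Prod>i\<in>UNIV. chi2 (\<xi> $ i * x $ i) * wave (half_ind e i) j (a $ i) (x $ i))" for x
    by (simp only: Psi0_eq_prod dot2_def chi2_sum prod.distrib mult_ac)
  moreover note integral_haar2_vec_prod[of "\<lambda>i t. chi2 (\<xi> $ i * t) * wave (half_ind e i) j (a $ i) t",
      OF integrable_chi2_wave]
  ultimately show ?thesis
    by (simp only: fourier2_def integral_mult_right_zero integral_chi2_wave)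
qed

text \<open>Every factor must be nonzero. For \<open>i \<in> e\<close> the shift
  \<open>1 / 2\<close> has norm 2, so \<open>2 powi (- j) * \<xi> $ i\<close> can come within 1 of
  its negative only with norm exactly 2; the other coordinates have norm at most 1 after scaling.
  Since \<open>e\<close> is nonempty, the maximum is attained.\<close>

lemma fourier2_Psi0_support:
  fixes a :: "q2 ^ 'n::finite"
  assumes "e \<noteq> {}" "fourier2 (Psi0 e j a) \<xi> \<noteq> 0"
  shows "norm2_vec \<xi> = 2 powi (1 - j)"
proof -
  have n: "norm2 (2 powi (- j) * \<xi> $ i + half_ind e i) \<le> 1" for i
  proof (rule ccontr)
    assume "\<not> ?thesis"
    then have "fourier2 (Psi0 e j a) \<xi> = 0"
      unfolding fourier2_Psi0 by (intro mult_eq_0_iff[THEN iffD2] disjI2 prod_zero bexI[of _ i]) auto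
    then show False using assms(2) by simp
  qed
  have scale: "norm2 (2 powi (- j) * \<xi> $ i) = 2 powi j * norm2 (\<xi> $ i)" for i
    by (simp only: norm2_mult norm2_two_powi) simp
  have in_e: "norm2 (\<xi> $ i) = 2 powi (1 - j)" if "i \<in> e" for i
  proof -
    have "norm2 (- (1 / 2) - 2 powi (- j) * \<xi> $ i) < norm2 (- (1 / 2))"
      using n[of i] that norm2_minus[of "2 powi (- j) * \<xi> $ i + 1 / 2"]
      by (simp add: norm2_minus norm2_divide norm2_two algebra_simps)
    from norm2_eqI[OF this] have "2 powi j * norm2 (\<xi> $ i) = 2"
      unfolding scale by (simp add: norm2_minus norm2_divide norm2_two)
    then show ?thesis by (simp add: power_int_diff field_simps)
  qed
  have not_in_e: "norm2 (\<xi> $ i) \<le> 2 powi (1 - j)" if "i \<notin> e" for i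
  proof -
    have "2 powi j * norm2 (\<xi> $ i) \<le> 1" using n[of i] that scale[of i] by simp
    then show ?thesis by (simp add: power_int_diff field_simps)
  qed
  show ?thesis
  proof (rule antisym)
    show "norm2_vec \<xi> \<le> 2 powi (1 - j)"
      unfolding norm2_vec_le using in_e not_in_e by (metis order_refl)
    obtain i where "i \<in> e" using assms(1) by blast
    then show "2 powi (1 - j) \<le> norm2_vec \<xi>"
      using in_e[of i] norm2_vec_le[of \<xi> "norm2_vec \<xi>"] by (metis order_refl)
  qed
qed

text \<open>The zero frequency lies off the sphere supporting the transform, and the transform there
  is the plain integral.\<close>

lemma integral_Psi0:
  fixes a :: "q2 ^ 'n::finite"
  assumes "e \<noteq> {}"
  shows "fourier2 (Psi0 e j a) 0 = 0" "(LINT x|haar2_vec. Psi0 e j a x) = 0"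
proof -
  have "norm2_vec (0 :: q2 ^ 'n) = 0" by (simp add: norm2_vec_def)
  then show "fourier2 (Psi0 e j a) 0 = 0"
    using fourier2_Psi0_support[OF assms, of j a 0] by auto
  then show "(LINT x|haar2_vec. Psi0 e j a x) = 0"
    by (simp add: fourier2_def dot2_def)
qed

text \<open>Fourier inversion, proved directly for wavelets by applying the wave integral a second
  time. The factor \<open>c\<close> is carried along to become the eigenvalue.\<close>

lemma inv_fourier2_fourier2_Psi0:
  "inv_fourier2 (\<lambda>\<xi>. c * fourier2 (Psi0 e j a) \<xi>) x = c * Psi0 e j a x"
  for a :: "q2 ^ 'n::finite"
proof -
  let ?C = "of_real (2 powr (- real CARD('n) * of_int j / 2)) :: complex"
  let ?w = "\<lambda>i. wave (a $ i) (- j) (- half_ind e i)"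
  let ?k = "\<lambda>i. 2 powi j * chi2 (- (half_ind e i * a $ i))"
  \<comment> \<open>Recognises each factor of the transform as a wave in the frequency, up to the
    phase \<open>chi2 (- (h * b))\<close>.\<close>
  have f: "2 powi j * chi2 (2 powi (- j) * t * b) * (if norm2 (2 powi (- j) * t + h) \<le> 1 then 1 else 0) =
      2 powi j * chi2 (- (h * b)) * wave b (- j) (- h) t" for t b h
    by (simp add: wave_def algebra_simps flip: chi2_add)
  have "fourier2 (Psi0 e j a) \<xi> = ?C * (\<Prod>i\<in>UNIV. ?k i * ?w i (\<xi> $ i))" for \<xi>
    unfolding fourier2_Psi0 f ..
  moreover have "chi2 (- dot2 x \<xi>) = (\<Prod>i\<in>UNIV. chi2 (- (x $ i) * \<xi> $ i))" for \<xi>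
    by (simp only: dot2_def sum_negf[symmetric] mult_minus_left chi2_sum)
  ultimately have "chi2 (- dot2 x \<xi>) * (c * fourier2 (Psi0 e j a) \<xi>) =
      (c * ?C) * (\<Prod>i\<in>UNIV. ?k i * (chi2 (- (x $ i) * \<xi> $ i) * ?w i (\<xi> $ i)))" for \<xi>
    by (simp only: prod.distrib mult_ac)
  moreover note integral_haar2_vec_prod[of "\<lambda>i t. ?k i * (chi2 (- (x $ i) * t) * ?w i t)",
      OF integrable_mult_right[OF integrable_chi2_wave]]
  ultimately have inv: "inv_fourier2 (\<lambda>\<xi>. c * fourier2 (Psi0 e j a) \<xi>) x =
      (c * ?C) * (\<Prod>i\<in>UNIV. ?k i * (LINT t|haar2. chi2 (- (x $ i) * t) * ?w i t))"
    by (simp only: inv_fourier2_def integral_mult_right_zero)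
  have w: "?k i * (LINT t|haar2. chi2 (- (x $ i) * t) * ?w i t) = wave (half_ind e i) j (a $ i) (x $ i)"
    for i
  proof -
    \<comment> \<open>The second exchange of parameters restores the wave: the powers of two cancel
      and the two phases combine to \<open>chi2 (h * (2 powi j * y - b))\<close>.\<close>
    have g: "2 powi j * chi2 (- (h * b)) * (2 powi (- j) * chi2 (2 powi (- (- j)) * - y * - h) *
        (if norm2 (2 powi (- (- j)) * - y + b) \<le> 1 then 1 else 0)) = wave h j b y" for h b y
    proof -
      have "norm2 (2 powi (- (- j)) * - y + b) = norm2 (2 powi j * y - b)"
        using norm2_minus[of "2 powi j * y - b"] by simp
      moreover have "2 powi j * 2 powi (- j) = (1 :: complex)" by (simp add: power_int_minus)
      moreover have "chi2 (- (h * b)) * chi2 (2 powi (- (- j)) * - y * - h) = chi2 (h * (2 powi j * y - b))"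
        by (simp add: algebra_simps flip: chi2_add)
      moreover have "2 powi j * u * (2 powi (- j) * v * w) = (2 powi j * 2 powi (- j)) * (u * v) * w"
        for u v w :: complex
        by (simp only: mult_ac)
      ultimately show ?thesis unfolding wave_def by (simp only: mult_1_left)
    qed
    show ?thesis unfolding integral_chi2_wave by (rule g)
  qed
  show ?thesis unfolding inv w Psi0_eq_prod by (simp only: mult.assoc)
qed

lemma Psi0_test_function: "Psi0 e j a \<in> test_functions2"
  for a :: "q2 ^ 'n::finite"
proof -
  have "\<exists>r>0. \<forall>x y. norm2 (y - x) \<le> r \<longrightarrow> wave (half_ind e i) j (a $ i) y = wave (half_ind e i) j (a $ i) x" for i
    by (rule wave_locally_constant[of "half_ind e i" j "a $ i"]) blast
  then obtain r where r: "\<And>i. r i > 0"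
    "\<And>i x y. norm2 (y - x) \<le> r i \<Longrightarrow> wave (half_ind e i) j (a $ i) y = wave (half_ind e i) j (a $ i) x"
    by metis
  have "\<forall>\<^sub>F y in nhds x. Psi0 e j a y = Psi0 e j a x" for x
  proof -
    have "\<forall>\<^sub>F y in nhds x. norm2 (y $ i - x $ i) \<le> r i" for i
    proof -
      have "\<forall>\<^sub>F y in nhds x. dist y x < r i"
        using r(1) eventually_nhds_metric by blast
      then show ?thesis
      proof eventually_elim
        case (elim y)
        then show ?case using dist_vec_nth_le[of y i x] by (simp add: dist_q2_def)
      qed
    qed
    then have "\<forall>\<^sub>F y in nhds x. \<forall>i. norm2 (y $ i - x $ i) \<le> r i"
      by (simp add: eventually_all_finite)
    then show ?thesis
    proof eventually_elim
      case (elim y)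
      then have "wave (half_ind e i) j (a $ i) (y $ i) = wave (half_ind e i) j (a $ i) (x $ i)" for i
        using r(2) by blast
      then show ?case by (simp only: Psi0_eq_prod)
    qed
  qed
  moreover have "compact (closure {x. Psi0 e j a x \<noteq> 0})"
  proof -
    let ?c = "\<chi> i. 2 powi (- j) * a $ i"
    \<comment> \<open>Distance on vectors is Euclidean rather than the maximum, so it is bounded by
      the sum of the coordinate distances; boundedness is enough by the Heine-Borel
      property.\<close>
    have "dist ?c x \<le> (\<Sum>i\<in>(UNIV :: 'n set). 2 powi j)" if "Psi0 e j a x \<noteq> 0" for x
    proof -
      have "dist (?c $ i) (x $ i) \<le> 2 powi j" for i
      proof -
        have "wave (half_ind e i) j (a $ i) (x $ i) \<noteq> 0"
          using that unfolding Psi0_eq_prod by auto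
        then have "norm2 (2 powi j * x $ i - a $ i) \<le> 1" by (auto simp: wave_def split: if_splits)
        then have "norm2 (x $ i - 2 powi (- j) * a $ i) \<le> 2 powi j"
          unfolding norm2_affine by (simp add: power_int_minus field_simps)
        then show ?thesis by (simp add: dist_q2_def norm2_minus_commute)
      qed
      then show ?thesis unfolding dist_vec_def
        by (intro order_trans[OF L2_set_le_sum] sum_mono) auto
    qed
    then have "bounded {x. Psi0 e j a x \<noteq> 0}" unfolding bounded_def by blast
    then show ?thesis by (simp add: compact_closure)
  qed
  ultimately show ?thesis by (simp add: test_functions2_def)
qed

theorem corollary6p1:
  fixes e :: "'n::finite set" and j :: int and a :: "q2 ^ 'n" and \<alpha> :: complex
  assumes "e \<noteq> {}" and "a \<in> I2_vec"
  shows "taibleson2_eigenfunction \<alpha> (2 powr (\<alpha> * of_int (1 - j))) (Psi0 e j a)"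
  unfolding taibleson2_eigenfunction_def
proof (intro conjI)
  show "Psi0 e j a \<in> lizorkin2"
    using Psi0_test_function integral_Psi0(2)[OF assms(1)] by (simp add: lizorkin2_def)
  \<comment> \<open>For nontriviality the wavelet is evaluated at the centre of its support, where
    every wave factor is 1.\<close>
  have "2 powi j * 2 powi (- j) = (1 :: q2)" by (simp add: power_int_minus)
  then have "Psi0 e j a (\<chi> i. 2 powi (- j) * a $ i) \<noteq> 0"
    by (simp add: Psi0_eq_prod wave_def flip: mult.assoc)
  then show "Psi0 e j a \<noteq> (\<lambda>_. 0)" by auto
  \<comment> \<open>For complex \<alpha> the two powers are compared through principal logarithms,
    which are real at positive reals, so no branch ambiguity arises.\<close>
  have "of_real (2 powi (1 - j)) powr \<alpha> = 2 powr (\<alpha> * of_int (1 - j))"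
  proof -
    have "(2 :: real) powi (1 - j) = 2 powr of_int (1 - j)"
      by (rule powr_real_of_int'[symmetric]) simp_all
    then have "ln (2 powi (1 - j)) = of_int (1 - j) * ln (2 :: real)"
      by (simp only: ln_powr)
    moreover have "Ln (of_real (2 powi (1 - j))) = of_real (ln (2 powi (1 - j)))"
      by (rule Ln_of_real) simp
    moreover have "Ln 2 = of_real (ln 2)"
      using Ln_of_real[of 2] by simp
    ultimately have "Ln (of_real (2 powi (1 - j))) = of_int (1 - j) * Ln 2"
      by (simp only: of_real_mult of_real_of_int_eq)
    then show ?thesis by (simp add: powr_def mult.assoc)
  qed
  \<comment> \<open>On the support of the transform the symbol is this constant; elsewhere both
    sides vanish, and this includes \<open>\<xi> = 0\<close>, consistently with the default
    value.\<close>
  then have "(if \<xi> = 0 then 0 else of_real (norm2_vec \<xi>) powr \<alpha> * fourier2 (Psi0 e j a) \<xi>) =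
      2 powr (\<alpha> * of_int (1 - j)) * fourier2 (Psi0 e j a) \<xi>" for \<xi>
    using fourier2_Psi0_support[OF assms(1)] integral_Psi0(1)[OF assms(1)]
    by (cases "fourier2 (Psi0 e j a) \<xi> = 0") auto
  then show "taibleson2 \<alpha> (Psi0 e j a) = (\<lambda>x. 2 powr (\<alpha> * of_int (1 - j)) * Psi0 e j a x)"
    by (simp only: taibleson2_def inv_fourier2_fourier2_Psi0 ext)
qed

end
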